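(* For all $\ell\in\mathbb Z_+$ and all finitely supported $\mathbf n=(n_i)_{i\ge1}$ in $\mathbb Z_+$ with $n_i=0$ for $i>k$, $$M_{\ell;\mathbf n}(q^{-1})=q^{-\frac12\sum_in_i-\frac14(\ell+\mathbf n\cdot A\mathbf n)}\ \langle 0|\prod_{i=1}^k\widehat Q_i^{\,n_i}|\ell\rangle .$$
   Context: $\mathbb Z_+=\{0,1,2,\dots\}$, $q=t^{-2}$ ($t$ an indeterminate), $A_{i,j}=\min(i,j)$. For $a\in\mathbb Z_+$, $b\in\mathbb Z$, $\left[\begin{matrix}a+b\\ a\end{matrix}\right]_q$ is the coefficient of $x^a$ in $\prod_{i=0}^{b}(1-q^ix)^{-1}$ if $b\ge0$, and in $\prod_{i=0}^{-b-1}(1-q^{i+b+1}x)$ if $b<0$. With $p_j=\sum_{i}\min(i,j)(n_i-2m_i)$, $q_0=\ell+\sum_i i(2m_i-n_i)$, $Q(\mathbf m,\mathbf n)=\mathbf m^tA(\mathbf m-\mathbf n)$, set $$M^{(K)}_{\ell;\mathbf n}(q^{-1})=\sum_{\substack{m_1,\dots,m_K\in\mathbb Z_+\\ q_0=0;\ p_1,\dots,p_K\ge0}}q^{Q(\mathbf m,\mathbf n)}\prod_{i=1}^K\left[\begin{matrix}m_i+p_i\\ m_i\end{matrix}\right]_q;$$ $M_{\ell;\mathbf n}(q^{-1})$ is its value for $K$ sufficiently large (it is independent of $K$ as soon as $n_i=0$ for $i>K$ and $2K\ge\sum_i i\,n_i$). Let $\widehat Q_0,\widehat Q_1$ be invertible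 with $\widehat Q_0\widehat Q_1=t\,\widehat Q_1\widehat Q_0$, and define $\widehat Q_j$ ($j\in\mathbb Z$) by the quantum $Q$-system $t\,\widehat Q_{j+1}\widehat Q_{j-1}=\widehat Q_j^2-1$; then $\widehat Q_j\widehat Q_{j+1}=t\,\widehat Q_{j+1}\widehat Q_j$ and all $\widehat Q_j$ lie in the quantum torus $\mathbb Z[t^{\pm1}]\langle\widehat Q_0^{\pm1},\widehat Q_1^{\pm1}\rangle$. Let $\mathcal A_+$ be the $\mathbb Z[t^{\pm1}]$-algebra generated by $\widehat Q_0,\widehat Q_0^{-1},\widehat Q_m$ ($m\ge1$), viewed inside this quantum torus. Consider the cyclic representation of $\mathcal A_+$ (acting from the right) with cyclic vector $\langle0|$ and $\mathbb Z[t^{\pm1}]$-basis $\langle m|$, $m\in\mathbb Z_+$, such that $$\langle0|\widehat Q_0=t^{-1}\langle0|,\qquad \langle m|=t^{m+1}\langle0|\widehat Q_m\quad(m>0).$$ Let $|\ell\rangle$, $\ell\in\mathbb Z_+$, be the dual basis: $\langle m|\ell\rangle=\delta_{m,\ell}$. Products of non-commuting factors are ordered with indices increasing from left to right. *)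

theory Defs
  imports
    "HOL-Library.Poly_Mapping"
    "HOL-Library.FuncSet"
    "HOL-Computational_Algebra.Formal_Power_Series"
begin

section \<open>Coefficient rings\<close>

text \<open>The ring of Laurent polynomials in \<open>t\<close> over the integers, realised as the integral group ring
  of the additive group of integers: \<open>Poly_Mapping.single k 1\<close> is \<open>t\<close> to the power \<open>k\<close>.\<close>

type_synonym laurent = "int \<Rightarrow>\<^sub>0 int"

definition tpow :: "int \<Rightarrow> laurent" where
  "tpow k = Poly_Mapping.single k 1"

definition qpow :: "int \<Rightarrow> laurent" where
  "qpow k = tpow (- 2 * k)"

text \<open>The prefactor of the theorem is a power of \<open>q\<close> with exponent in \<open>(1/4)\<int>\<close>, which need not lie in
  \<^typ>\<open>laurent\<close>.  The final identity is therefore an identity of integral polynomials in rational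
  powers of \<open>t\<close>, into which \<^typ>\<open>laurent\<close> embeds.\<close>

type_synonym puiseux = "rat \<Rightarrow>\<^sub>0 int"

definition qpow_rat :: "rat \<Rightarrow> puiseux" where
  "qpow_rat r = Poly_Mapping.single (- 2 * r) 1"

definition puiseux_of :: "laurent \<Rightarrow> puiseux" where
  "puiseux_of = frag_extend (\<lambda>k. frag_of (of_int k))"


section \<open>The fermionic sum\<close>

text \<open>The power series \<open>1 / (1 - c x)\<close>.\<close>

definition geom_fps :: "laurent \<Rightarrow> laurent fps" where
  "geom_fps c = Abs_fps (\<lambda>n. c ^ n)"

lemma geom_fps_inverse: "(1 - fps_const c * fps_X) * geom_fps c = 1"
proof (rule fps_ext)
  fix n
  show "fps_nth ((1 - fps_const c * fps_X) * geom_fps c) n = fps_nth 1 n"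
    by (cases n) (simp_all add: geom_fps_def ring_distribs mult.assoc)
qed

text \<open>\<open>qbin a b\<close> is the Gaussian binomial with top entry \<open>a + b\<close> and bottom entry \<open>a\<close>.\<close>

definition qbin :: "nat \<Rightarrow> int \<Rightarrow> laurent" where
  "qbin a b =
     (if b \<ge> 0 then fps_nth (\<Prod>i\<in>{0..b}. geom_fps (qpow i)) a
      else fps_nth (\<Prod>i\<in>{0..- b - 1}. 1 - fps_const (qpow (i + b + 1)) * fps_X) a)"

definition vac_p :: "nat \<Rightarrow> (nat \<Rightarrow> nat) \<Rightarrow> (nat \<Rightarrow> nat) \<Rightarrow> nat \<Rightarrow> int" where
  "vac_p K n m j = (\<Sum>i=1..K. int (min i j) * (int (n i) - 2 * int (m i)))"

definition vac_q0 :: "nat \<Rightarrow> nat \<Rightarrow> (nat \<Rightarrow> nat) \<Rightarrow> (nat \<Rightarrow> nat) \<Rightarrow> int" where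
  "vac_q0 K l n m = int l + (\<Sum>i=1..K. int i * (2 * int (m i) - int (n i)))"

definition quad_Q :: "nat \<Rightarrow> (nat \<Rightarrow> nat) \<Rightarrow> (nat \<Rightarrow> nat) \<Rightarrow> int" where
  "quad_Q K n m = (\<Sum>i=1..K. \<Sum>j=1..K. int (m i) * int (min i j) * (int (m j) - int (n j)))"

text \<open>The summation tuples \<open>(m\<^sub>1, \<dots>, m\<^sub>K)\<close> are represented by extensional functions on \<open>{1..K}\<close>.\<close>

definition M_index :: "nat \<Rightarrow> nat \<Rightarrow> (nat \<Rightarrow> nat) \<Rightarrow> (nat \<Rightarrow> nat) set" where
  "M_index K l n =
     {m \<in> {1..K} \<rightarrow>\<^sub>E UNIV. vac_q0 K l n m = 0 \<and> (\<forall>j\<in>{1..K}. vac_p K n m j \<ge> 0)}"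

lemma finite_M_index: "finite (M_index K l n)"
proof (rule finite_subset)
  let ?N = "\<Sum>i=1..K. i * n i"
  show "M_index K l n \<subseteq> {1..K} \<rightarrow>\<^sub>E {..?N}"
  proof
    fix m assume m: "m \<in> M_index K l n"
    then have ext: "m \<in> {1..K} \<rightarrow>\<^sub>E UNIV" and q0: "vac_q0 K l n m = 0"
      by (auto simp: M_index_def)
    from q0 have "int l + 2 * (\<Sum>i=1..K. int i * int (m i)) = (\<Sum>i=1..K. int i * int (n i))"
      by (simp add: vac_q0_def right_diff_distrib sum_subtractf sum_distrib_left mult.left_commute)
    then have "int (l + 2 * (\<Sum>i=1..K. i * m i)) = int ?N" by simp
    then have le: "(\<Sum>i=1..K. i * m i) \<le> ?N" by linarith
    have "m i \<le> ?N" if "i \<in> {1..K}" for i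
    proof -
      have "m i \<le> i * m i" using that by simp
      also have "\<dots> \<le> (\<Sum>i=1..K. i * m i)"
        using that by (intro member_le_sum) auto
      finally show ?thesis using le by linarith
    qed
    with ext show "m \<in> {1..K} \<rightarrow>\<^sub>E {..?N}" by (auto simp: PiE_iff)
  qed
  show "finite ({1..K} \<rightarrow>\<^sub>E {..?N})" by (intro finite_PiE) auto
qed

text \<open>The values at \<open>q\<inverse>\<close> of the truncated sum and of its stable limit, as elements of \<open>\<int>[t, t\<inverse>]\<close>
  with \<open>q = t\<^sup>-\<^sup>2\<close>.\<close>

definition M_trunc :: "nat \<Rightarrow> nat \<Rightarrow> (nat \<Rightarrow> nat) \<Rightarrow> laurent" where
  "M_trunc K l n =
     (\<Sum>m\<in>M_index K l n. qpow (quad_Q K n m) * (\<Prod>i=1..K. qbin (m i) (vac_p K n m i)))"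

definition M_stable :: "nat \<Rightarrow> (nat \<Rightarrow> nat) \<Rightarrow> laurent" where
  "M_stable l n = (THE c. eventually (\<lambda>K. M_trunc K l n = c) sequentially)"


section \<open>The quantum torus and the quantum Q-system\<close>

text \<open>\<open>TMon c a b\<close> stands for the normally ordered monomial \<open>t\<^sup>c Q\<^sub>0\<^sup>a Q\<^sub>1\<^sup>b\<close>.  These monomials form a
  group (written additively, although it is not commutative, in order to match the convolution
  product of \<^theory>\<open>HOL-Library.Poly_Mapping\<close>), and the quantum torus is its integral group ring.\<close>

datatype tmon = TMon int int int

instantiation tmon :: group_add
begin

definition zero_tmon :: tmon where
  "zero_tmon = TMon 0 0 0"

text \<open>\<open>Q\<^sub>0 Q\<^sub>1 = t Q\<^sub>1 Q\<^sub>0\<close> gives \<open>Q\<^sub>1\<^sup>b Q\<^sub>0\<^sup>a = t\<^sup>-\<^sup>a\<^sup>b Q\<^sub>0\<^sup>a Q\<^sub>1\<^sup>b\<close>.\<close>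

fun plus_tmon :: "tmon \<Rightarrow> tmon \<Rightarrow> tmon" where
  "TMon c a b + TMon c' a' b' = TMon (c + c' - b * a') (a + a') (b + b')"

fun uminus_tmon :: "tmon \<Rightarrow> tmon" where
  "- TMon c a b = TMon (- c - a * b) (- a) (- b)"

definition minus_tmon :: "tmon \<Rightarrow> tmon \<Rightarrow> tmon" where
  "minus_tmon x y = x + (- y)"

instance
proof
  fix x y z :: tmon
  show "x + y + z = x + (y + z)"
    by (cases x; cases y; cases z) (simp add: algebra_simps)
  show "0 + x = x" "x + 0 = x" "- x + x = 0"
    by (cases x; simp add: zero_tmon_def)+
  show "x + - y = x - y" by (simp add: minus_tmon_def)
qed

end

type_synonym qtorus = "tmon \<Rightarrow>\<^sub>0 int"

definition tor :: "int \<Rightarrow> int \<Rightarrow> int \<Rightarrow> qtorus" where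
  "tor c a b = Poly_Mapping.single (TMon c a b) 1"

lemma tor_mult: "tor c a b * tor c' a' b' = tor (c + c' - b * a') (a + a') (b + b')"
  by (simp add: tor_def mult_single)

lemma tor_one: "tor 0 0 0 = 1"
  by (simp add: tor_def flip: zero_tmon_def)

lemma torus_relation: "tor 0 1 0 * tor 0 0 1 = tor 1 0 0 * (tor 0 0 1 * tor 0 1 0)"
  by (simp add: tor_mult)

text \<open>The central embedding of scalars.\<close>

definition torus_of :: "laurent \<Rightarrow> qtorus" where
  "torus_of = frag_extend (\<lambda>k. frag_of (TMon k 0 0))"

text \<open>Since the quantum torus has no zero divisors, this determines \<open>Q\<close> uniquely.\<close>

definition quantum_Q_system :: "(int \<Rightarrow> qtorus) \<Rightarrow> bool" where
  "quantum_Q_system Q \<longleftrightarrow>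
     Q 0 = tor 0 1 0 \<and> Q 1 = tor 0 0 1 \<and>
     (\<forall>j. torus_of (tpow 1) * Q (j + 1) * Q (j - 1) = Q j ^ 2 - 1)"

inductive_set A_plus :: "(int \<Rightarrow> qtorus) \<Rightarrow> qtorus set" for Q :: "int \<Rightarrow> qtorus" where
  scalar: "torus_of c \<in> A_plus Q"
| Q0: "Q 0 \<in> A_plus Q"
| Q0_inv: "tor 0 (- 1) 0 \<in> A_plus Q"
| Qm: "m \<ge> 1 \<Longrightarrow> Q m \<in> A_plus Q"
| add: "x \<in> A_plus Q \<Longrightarrow> y \<in> A_plus Q \<Longrightarrow> x + y \<in> A_plus Q"
| mult: "x \<in> A_plus Q \<Longrightarrow> y \<in> A_plus Q \<Longrightarrow> x * y \<in> A_plus Q"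


section \<open>The cyclic representation\<close>

text \<open>A right representation on a \<open>\<int>[t, t\<inverse>]\<close>-module (the whole type \<open>'v\<close>), with \<open>bra m\<close> for \<open>\<langle>m|\<close>.  The
  value of \<open>act v x\<close> is constrained only for \<open>x\<close> in \<^const>\<open>A_plus\<close>.\<close>

locale cyclic_right_rep = module scale
  for scale :: "laurent \<Rightarrow> 'v::ab_group_add \<Rightarrow> 'v" +
  fixes Q :: "int \<Rightarrow> qtorus"
    and act :: "'v \<Rightarrow> qtorus \<Rightarrow> 'v"
    and bra :: "nat \<Rightarrow> 'v"
  assumes act_add_left: "x \<in> A_plus Q \<Longrightarrow> act (v + w) x = act v x + act w x"
    and act_scale_left: "x \<in> A_plus Q \<Longrightarrow> act (scale c v) x = scale c (act v x)"
    and act_add_right: "x \<in> A_plus Q \<Longrightarrow> y \<in> A_plus Q \<Longrightarrow> act v (x + y) = act v x + act v y"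
    and act_mult: "x \<in> A_plus Q \<Longrightarrow> y \<in> A_plus Q \<Longrightarrow> act v (x * y) = act (act v x) y"
    and act_scalar: "act v (torus_of c) = scale c v"
    and cyclic: "act (bra 0) ` A_plus Q = UNIV"
    and inj_bra: "inj bra"
    and independent_bra: "\<not> dependent (range bra)"
    and span_bra: "span (range bra) = UNIV"
    and bra_0: "act (bra 0) (Q 0) = scale (tpow (- 1)) (bra 0)"
    and bra_pos: "m > 0 \<Longrightarrow> bra m = scale (tpow (int m + 1)) (act (bra 0) (Q (int m)))"

text \<open>\<open>ket l v\<close> is the pairing \<open>\<langle>v|l\<rangle>\<close>.\<close>

definition dual_basis ::
  "(laurent \<Rightarrow> 'v::ab_group_add \<Rightarrow> 'v) \<Rightarrow> (nat \<Rightarrow> 'v) \<Rightarrow> (nat \<Rightarrow> 'v \<Rightarrow> laurent) \<Rightarrow> bool" where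
  "dual_basis scale bra ket \<longleftrightarrow>
     (\<forall>l. module_hom scale (*) (ket l)) \<and>
     (\<forall>m l. ket l (bra m) = (if m = l then 1 else 0))"

end

theory Submission
  imports Defs
begin

text \<open>Both sides satisfy the same two recursions in \<open>n\<close>, and these determine everything by induction on
  \<open>\<Sum> i n\<^sub>i\<close>. With \<open>e\<^sub>i\<close> for a unit step of \<open>n\<^sub>i\<close>, the first one replaces \<open>2 e\<^sub>k\<close> by
  \<open>e\<^bsub>k-1\<^esub> + e\<^bsub>k+1\<^esub>\<close> and by \<open>0\<close>: on the fermionic side it is the \<open>q\<close>-Pascal identity at position \<open>k\<close>, on
  the other side it is the quantum \<open>Q\<close>-system. The second one applies when \<open>n\<close> is supported on \<open>{1..k}\<close> and
  relates \<open>n + e\<^bsub>k+1\<^esub>\<close> and \<open>n + e\<^bsub>k-1\<^esub>\<close> at \<open>l\<close> to \<open>n + e\<^sub>k\<close> at \<open>l \<plusminus> 1\<close>. On the operator side it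
  expresses the linear recursion \<open>Q\<^sub>k C = t Q\<^bsub>k+1\<^esub> + Q\<^bsub>k-1\<^esub>\<close> for the conserved quantity \<open>C\<close> together
  with \<open>\<langle>m|C = \<langle>m+1| + t \<langle>m-1|\<close>. On the fermionic side the two differences are telescoped by
  \<open>q\<close>-Pascal through vectors \<open>n\<close> with negative entries, and the remainder terms coincide.\<close>

section \<open>The fermionic sum\<close>

lemma tpow_0 [simp]: "tpow 0 = 1"
  by (simp add: tpow_def)

lemma tpow_add: "tpow (a + b) = tpow a * tpow b"
  by (simp add: tpow_def mult_single)

lemma qpow_0 [simp]: "qpow 0 = 1"
  by (simp add: qpow_def)

lemma qpow_add: "qpow (a + b) = qpow a * qpow b"
  by (simp add: qpow_def algebra_simps flip: tpow_add)

lemma qpow_of_nat: "qpow (int n) = qpow 1 ^ n"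
  by (induction n) (simp_all add: qpow_add)

text \<open>The substitution \<open>x -> c x\<close>. For \<open>c = q\<close> it shifts all factors
  \<open>1/(1 - q^i x)\<close> of the generating function by one.\<close>

definition fps_dilate :: "'a::comm_ring_1 \<Rightarrow> 'a fps \<Rightarrow> 'a fps" where
  "fps_dilate c f = Abs_fps (\<lambda>n. c ^ n * fps_nth f n)"

lemma fps_dilate_1: "fps_dilate c 1 = 1"
  by (rule fps_ext) (simp add: fps_dilate_def)

lemma fps_dilate_mult: "fps_dilate c (f * g) = fps_dilate c f * fps_dilate c g"
proof (rule fps_ext)
  fix n
  have "c ^ n * (fps_nth f i * fps_nth g (n - i)) =
      c ^ i * fps_nth f i * (c ^ (n - i) * fps_nth g (n - i))" if "i \<le> n" for i
  proof -
    have "c ^ n = c ^ i * c ^ (n - i)"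
      using that by (simp flip: power_add)
    then show ?thesis by (simp add: mult_ac)
  qed
  then show "fps_nth (fps_dilate c (f * g)) n = fps_nth (fps_dilate c f * fps_dilate c g) n"
    by (simp add: fps_dilate_def fps_mult_nth sum_distrib_left)
qed

lemma fps_dilate_prod:
  "fps_dilate c (\<Prod>i<n. f i) = (\<Prod>i<n. fps_dilate c (f i))" for n :: nat
  by (induction n) (simp_all add: fps_dilate_1 fps_dilate_mult)

lemma fps_dilate_geom: "fps_dilate c (geom_fps d) = geom_fps (c * d)"
  by (rule fps_ext) (simp add: fps_dilate_def geom_fps_def power_mult_distrib)

lemma qbin_of_nat:
  "qbin a (int b) = fps_nth (\<Prod>i<Suc b. geom_fps (qpow (int i))) a"
proof -
  have "{0..int b} = int ` {..<Suc b}"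
    by (auto simp: image_iff) (metis lessThan_iff less_Suc_eq_le nat_int nat_mono zero_le_imp_eq_int)
  then show ?thesis
    by (simp add: qbin_def prod.reindex del: prod.lessThan_Suc)
qed

lemma qbin_0_left: "b \<ge> 0 \<Longrightarrow> qbin 0 b = 1"
  by (simp add: qbin_def fps_prod_nth' geom_fps_def)

lemma qbin_0_right: "qbin a 0 = 1"
  by (simp add: qbin_def geom_fps_def)

text \<open>Let \<open>F_b\<close> be the product of \<open>1/(1 - q^i x)\<close> over
  \<open>i = 0..b\<close>. Cancelling the factor with \<open>i = 0\<close> gives
  \<open>(1 - x) F_{b+1}(x) = F_b(q x)\<close>; the claim compares the coefficients of
  \<open>x^{a+1}\<close>.\<close>

lemma qbin_pascal:
  "qbin (Suc a) (int (Suc b)) = qpow (int (Suc a)) * qbin (Suc a) (int b) + qbin a (int (Suc b))"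
proof -
  let ?F = "\<lambda>b. \<Prod>i<Suc b. geom_fps (qpow (int i))"
  have "?F (Suc b) = geom_fps 1 * (\<Prod>i<Suc b. geom_fps (qpow (int (Suc i))))"
    by (subst prod.lessThan_Suc_shift) simp
  also have "(\<Prod>i<Suc b. geom_fps (qpow (int (Suc i)))) = fps_dilate (qpow 1) (?F b)"
    by (simp only: fps_dilate_prod fps_dilate_geom) (simp add: qpow_add)
  finally have "(1 - fps_const 1 * fps_X) * ?F (Suc b) = fps_dilate (qpow 1) (?F b)"
    by (simp only: mult.assoc [symmetric] geom_fps_inverse mult_1_left)
  then have "fps_nth ((1 - fps_X) * ?F (Suc b)) (Suc a) = fps_nth (fps_dilate (qpow 1) (?F b)) (Suc a)"
    by simp
  then have "qbin (Suc a) (int (Suc b)) - qbin a (int (Suc b)) = qpow 1 ^ Suc a * qbin (Suc a) (int b)"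
    unfolding qbin_of_nat by (simp add: left_diff_distrib fps_dilate_def del: prod.lessThan_Suc)
  then show ?thesis
    by (simp only: qpow_of_nat [of "Suc a"] diff_eq_eq)
qed

definition rbin :: "nat \<Rightarrow> int \<Rightarrow> laurent" where
  "rbin a p = (if p \<ge> 0 then qbin a p else 0)"

lemma rbin_neg: "p < 0 \<Longrightarrow> rbin a p = 0"
  by (simp add: rbin_def)

lemma rbin_0_left: "p \<ge> 0 \<Longrightarrow> rbin 0 p = 1"
  by (simp add: rbin_def qbin_0_left)

text \<open>The cut-off at negative \<open>p\<close> leaves q-Pascal intact except at
  \<open>a = p = 0\<close>, where the left side is \<open>1\<close> and both terms on the right
  vanish.\<close>

lemma rbin_pascal:
  assumes "\<not> (a = 0 \<and> p = 0)"
  shows "rbin a p = qpow (int a) * rbin a (p - 1) + (if a = 0 then 0 else rbin (a - 1) p)"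
proof -
  consider "p < 0" | "p = 0" | "p > 0" by linarith
  then show ?thesis
  proof cases
    case 3
    then obtain b where p: "p = int (Suc b)" by (metis gr0_implies_Suc zero_less_imp_eq_int)
    show ?thesis
    proof (cases a)
      case 0
      then show ?thesis using p by (simp add: rbin_def qbin_0_left)
    next
      case (Suc c)
      then show ?thesis using qbin_pascal [of c b] p by (simp add: rbin_def)
    qed
  qed (use assms in \<open>auto simp: rbin_def qbin_0_right\<close>)
qed

text \<open>The sum depends on \<open>n\<close> only through the vector \<open>a = A n\<close>. Arbitrary integral \<open>a\<close> are allowed, that is,
  \<open>n\<close> with negative entries; \<^term>\<open>rbin\<close> vanishes for negative \<open>p\<close>, which encodes \<open>p\<^sub>j \<ge> 0\<close>.\<close>

definition min_sum :: "nat \<Rightarrow> (nat \<Rightarrow> nat) \<Rightarrow> nat \<Rightarrow> int" where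
  "min_sum K m i = (\<Sum>j=1..K. int (min i j) * int (m j))"

definition fsummand :: "nat \<Rightarrow> (nat \<Rightarrow> int) \<Rightarrow> (nat \<Rightarrow> nat) \<Rightarrow> laurent" where
  "fsummand K a m = qpow (\<Sum>i=1..K. int (m i) * (min_sum K m i - a i)) *
     (\<Prod>i=1..K. rbin (m i) (a i - 2 * min_sum K m i))"

text \<open>For \<open>a = A n\<close> the entry \<open>K\<close> of \<open>a - 2 A m\<close> is
  \<open>p_K = l - q_0\<close>, because \<open>min i K = i\<close> for \<open>i\<close> up to
  \<open>K\<close>. So this is the condition \<open>q_0 = 0\<close>; the conditions
  \<open>p_j >= 0\<close> sit in the summand.\<close>

definition findex :: "nat \<Rightarrow> (nat \<Rightarrow> int) \<Rightarrow> int \<Rightarrow> (nat \<Rightarrow> nat) set" where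
  "findex K a l = {m \<in> {1..K} \<rightarrow>\<^sub>E UNIV. a K - 2 * min_sum K m K = l}"

definition fsum :: "nat \<Rightarrow> (nat \<Rightarrow> int) \<Rightarrow> int \<Rightarrow> laurent" where
  "fsum K a l = (\<Sum>m\<in>findex K a l. fsummand K a m)"

lemma min_sum_0 [simp]: "min_sum K m 0 = 0"
  by (simp add: min_sum_def)

lemma min_sum_nonneg: "min_sum K m i \<ge> 0"
  by (simp add: min_sum_def sum_nonneg)

lemma min_sum_beyond: "i \<ge> K \<Longrightarrow> min_sum K m i = (\<Sum>j=1..K. int j * int (m j))"
  unfolding min_sum_def by (intro sum.cong) auto

lemma min_sum_ge:
  assumes "j \<in> {1..K}"
  shows "int (min i j) * int (m j) \<le> min_sum K m i"
  unfolding min_sum_def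
  using assms by (intro member_le_sum [where f = "\<lambda>j. int (min i j) * int (m j)"]) auto

text \<open>As a function of \<open>j\<close>, \<open>min j i\<close> is linear apart from a kink at
  \<open>j = i\<close>, so its second difference is minus a Kronecker delta. For
  \<open>j = K\<close> the entry \<open>K + 1\<close> is read, which equals the entry
  \<open>K\<close>.\<close>

lemma min_sum_second_diff:
  assumes "j \<in> {1..K}"
  shows "min_sum K m (j - 1) + min_sum K m (j + 1) = 2 * min_sum K m j - int (m j)"
proof -
  have *: "int (min (j - 1) i) * int (m i) + int (min (j + 1) i) * int (m i) =
      2 * (int (min j i) * int (m i)) - (if i = j then int (m i) else 0)" if "i \<in> {1..K}" for i
  proof -
    have "int (min (j - 1) i) + int (min (j + 1) i) = 2 * int (min j i) - (if i = j then 1 else 0)"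
      using assms by (auto simp: min_def)
    then have "(int (min (j - 1) i) + int (min (j + 1) i)) * int (m i) =
        (2 * int (min j i) - (if i = j then 1 else 0)) * int (m i)"
      by (rule arg_cong)
    then show ?thesis by (auto simp: algebra_simps)
  qed
  have "min_sum K m (j - 1) + min_sum K m (j + 1) =
      (\<Sum>i=1..K. 2 * (int (min j i) * int (m i)) - (if i = j then int (m i) else 0))"
    unfolding min_sum_def sum.distrib [symmetric] by (intro sum.cong *) simp_all
  then show ?thesis
    using assms by (simp add: sum_subtractf min_sum_def sum_distrib_left)
qed

lemma finite_findex: "finite (findex K a l)"
proof (rule finite_subset)
  show "findex K a l \<subseteq> {1..K} \<rightarrow>\<^sub>E {..nat (a K - l)}"
  proof
    fix m assume m: "m \<in> findex K a l"
    have "m i \<le> nat (a K - l)" if "i \<in> {1..K}" for i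
    proof -
      have "int (m i) \<le> int i * int (m i)"
        using that by (simp add: mult_le_cancel_right1)
      also have "\<dots> \<le> min_sum K m K"
        using min_sum_ge [OF that, of K m] that by simp
      finally have "int (m i) \<le> a K - l"
        using m min_sum_nonneg [of K m K] by (simp add: findex_def)
      then show ?thesis by linarith
    qed
    with m show "m \<in> {1..K} \<rightarrow>\<^sub>E {..nat (a K - l)}"
      by (auto simp: findex_def PiE_iff)
  qed
  show "finite ({1..K} \<rightarrow>\<^sub>E {..nat (a K - l)})"
    by (intro finite_PiE) auto
qed

lemma fsum_cong:
  assumes "\<And>i. i \<in> {1..K} \<Longrightarrow> a i = b i" "K \<ge> 1"
  shows "fsum K a l = fsum K b l"
proof -
  have "fsummand K a m = fsummand K b m" for m
    using assms(1) unfolding fsummand_def by (intro arg_cong2 [where f = "(*)"] arg_cong [where f = qpow] sum.cong prod.cong) auto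
  moreover have "findex K a l = findex K b l"
    using assms by (simp add: findex_def)
  ultimately show ?thesis by (simp add: fsum_def)
qed

lemma fsummand_eq_0:
  assumes "i \<in> {1..K}" "a i - 2 * min_sum K m i < 0"
  shows "fsummand K a m = 0"
proof -
  have "(\<Prod>i=1..K. rbin (m i) (a i - 2 * min_sum K m i)) = 0"
    using assms by (intro prod_zero bexI [of _ i]) (auto simp: rbin_neg)
  then show ?thesis by (simp add: fsummand_def)
qed

section \<open>q-Pascal applied to one factor of the fermionic sum\<close>

lemma min_sum_upd:
  assumes "j \<in> {1..K}"
  shows "min_sum K (m(j := Suc (m j))) i = min_sum K m i + int (min i j)"
proof -
  have "min_sum K (m(j := Suc (m j))) i =
      (\<Sum>k=1..K. int (min i k) * int (m k) + (if k = j then int (min i j) else 0))"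
    unfolding min_sum_def by (intro sum.cong) (auto simp: algebra_simps)
  then show ?thesis using assms by (simp add: sum.distrib min_sum_def)
qed

text \<open>Expansion of the quadratic exponent at \<open>m + e_j\<close>; the cross term is
  absorbed into the linear part by passing from \<open>a\<close> to
  \<open>a - 2 A e_j\<close>.\<close>

lemma weight_upd:
  assumes "j \<in> {1..K}"
  shows "(\<Sum>i=1..K. int ((m(j := Suc (m j))) i) * (min_sum K (m(j := Suc (m j))) i - a i)) =
    (\<Sum>i=1..K. int (m i) * (min_sum K m i - (a i - 2 * int (min i j)))) + (int j - a j)"
proof -
  have "(\<Sum>i=1..K. int ((m(j := Suc (m j))) i) * (min_sum K (m(j := Suc (m j))) i - a i)) =
      (\<Sum>i=1..K. (int (m i) * (min_sum K m i - (a i - 2 * int (min i j))) - int (min j i) * int (m i))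
        + (if i = j then min_sum K m j + int j - a j else 0))"
    by (intro sum.cong) (auto simp: min_sum_upd [OF assms] algebra_simps min.commute)
  also have "\<dots> = (\<Sum>i=1..K. int (m i) * (min_sum K m i - (a i - 2 * int (min i j))))
      - min_sum K m j + (min_sum K m j + int j - a j)"
    using assms by (simp add: sum.distrib sum_subtractf min_sum_def)
  finally show ?thesis by simp
qed

text \<open>\<open>rbin_pascal\<close> is applied to the factor \<open>j\<close>. Its power
  \<open>q^{m_j}\<close> is what the exponent gains when \<open>a_j\<close> drops by one. In the
  other term \<open>m_j\<close> drops by one, and \<open>a - 2 A m\<close> stays fixed because
  \<open>a\<close> becomes \<open>a - 2 A e_j\<close> at the same time.\<close>

lemma fsummand_pascal:
  assumes j: "j \<in> {1..K}" and nz: "\<not> (m j = 0 \<and> a j - 2 * min_sum K m j = 0)"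
  shows "fsummand K a m = fsummand K (a(j := a j - 1)) m +
    qpow (int j - a j) * (if m j = 0 then 0 else fsummand K (\<lambda>i. a i - 2 * int (min i j)) (m(j := m j - 1)))"
proof -
  let ?p = "\<lambda>i. a i - 2 * min_sum K m i"
  define Z where "Z = (\<Prod>i\<in>{1..K}-{j}. rbin (m i) (?p i))"
  define w where "w = (\<Sum>i=1..K. int (m i) * (min_sum K m i - a i))"
  have fs: "fsummand K a m = qpow w * (rbin (m j) (?p j) * Z)"
    unfolding fsummand_def w_def Z_def using j by (simp add: prod.remove)
  have w1: "(\<Sum>i=1..K. int (m i) * (min_sum K m i - (a(j := a j - 1)) i)) = w + int (m j)"
  proof -
    have "(\<Sum>i=1..K. int (m i) * (min_sum K m i - (a(j := a j - 1)) i)) =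
       (\<Sum>i=1..K. int (m i) * (min_sum K m i - a i) + (if i = j then int (m j) else 0))"
      by (intro sum.cong) (auto simp: algebra_simps)
    then show ?thesis using j by (simp add: sum.distrib w_def)
  qed
  have "(\<Prod>i\<in>{1..K}-{j}. rbin (m i) ((a(j := a j - 1)) i - 2 * min_sum K m i)) = Z"
    unfolding Z_def by (intro prod.cong) auto
  then have f1: "fsummand K (a(j := a j - 1)) m = qpow (w + int (m j)) * (rbin (m j) (?p j - 1) * Z)"
    unfolding fsummand_def w1 using j by (simp add: prod.remove algebra_simps)
  show ?thesis
  proof (cases "m j")
    case 0
    then show ?thesis
      using rbin_pascal [of "m j" "?p j"] nz unfolding fs f1 by (auto simp: qpow_add)
  next
    case (Suc c)
    define m' where "m' = m(j := c)"
    have m: "m = m'(j := Suc (m' j))" and m'j: "m' j = c"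
      using Suc by (auto simp: m'_def)
    have w2: "(\<Sum>i=1..K. int (m' i) * (min_sum K m' i - (a i - 2 * int (min i j)))) = w - (int j - a j)"
      using weight_upd [OF j, of m' a] unfolding w_def by (simp flip: m)
    have p2: "a i - 2 * int (min i j) - 2 * min_sum K m' i = ?p i" for i
      using min_sum_upd [OF j, of m' i] by (simp flip: m)
    have "(\<Prod>i=1..K. rbin (m' i) (?p i)) = rbin c (?p j) * Z"
      unfolding Z_def using j m'j by (simp add: prod.remove m'_def)
    then have f2: "fsummand K (\<lambda>i. a i - 2 * int (min i j)) m' = qpow (w - (int j - a j)) * (rbin c (?p j) * Z)"
      unfolding fsummand_def w2 p2 by simp
    have m'': "m' = m(j := m j - 1)" using Suc by (simp add: m'_def)
    have "qpow (int j - a j) * qpow (w - (int j - a j)) = qpow w"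
      by (simp flip: qpow_add)
    then have "qpow (int j - a j) * fsummand K (\<lambda>i. a i - 2 * int (min i j)) m' = qpow w * (rbin c (?p j) * Z)"
      unfolding f2 by (simp flip: mult.assoc)
    then show ?thesis
      using rbin_pascal [of "m j" "?p j"] Suc unfolding fs f1 m'' [symmetric]
      by (simp add: qpow_add algebra_simps)
  qed
qed

text \<open>Concavity of \<open>a\<close> at \<open>j\<close> disposes of the exceptional case
  \<open>m_j = p_j = 0\<close> of q-Pascal: then \<open>p_{j-1} + p_{j+1} < 0\<close>, so a
  neighbouring entry of \<open>p\<close> is negative and both sides vanish. At the ends,
  \<open>p_0 = 0\<close> and \<open>p_{K+1} = p_K\<close>.\<close>

lemma fsummand_step:
  assumes j: "j \<in> {1..K}" and "a 0 = 0"
    and concave: "2 * a j - a (j - 1) - (if j = K then a j else a (j + 1)) \<ge> 1"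
  shows "fsummand K a m = fsummand K (a(j := a j - 1)) m +
    qpow (int j - a j) * (if m j = 0 then 0 else fsummand K (\<lambda>i. a i - 2 * int (min i j)) (m(j := m j - 1)))"
proof (cases "m j = 0 \<and> a j - 2 * min_sum K m j = 0")
  case True
  let ?p = "\<lambda>i. a i - 2 * min_sum K m i"
  have sd: "min_sum K m (j - 1) + min_sum K m (j + 1) = 2 * min_sum K m j"
    using min_sum_second_diff [OF j, of m] True by simp
  have "\<exists>i\<in>{1..K}. ?p i < 0 \<and> i \<noteq> j"
  proof (rule ccontr)
    assume "\<not> ?thesis"
    then have nn: "?p i \<ge> 0" if "i \<in> {1..K}" "i \<noteq> j" for i
      using that by (meson linorder_not_le)
    have "?p (j - 1) \<ge> 0"
    proof (cases "j = 1")
      case False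
      then have "j - 1 \<in> {1..K}" "j - 1 \<noteq> j" using j by auto
      then show ?thesis by (rule nn)
    qed (simp add: \<open>a 0 = 0\<close>)
    moreover have "(if j = K then a j else a (j + 1)) - 2 * min_sum K m (j + 1) \<ge> 0"
      using nn [of "j + 1"] j True min_sum_beyond [of K K m] min_sum_beyond [of K "K + 1" m] by auto
    ultimately show False
      using concave sd True by linarith
  qed
  then obtain i where i: "i \<in> {1..K}" "?p i < 0" "i \<noteq> j" by blast
  have "fsummand K a m = 0"
    using i by (intro fsummand_eq_0) auto
  moreover have "fsummand K (a(j := a j - 1)) m = 0"
    using i by (intro fsummand_eq_0 [of i]) auto
  ultimately show ?thesis using True by simp
next
  case False
  then show ?thesis by (rule fsummand_pascal [OF j])
qed

text \<open>Summation of \<open>fsummand_step\<close> over \<open>m\<close>, with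
  \<open>m - e_j\<close> as the new variable in the last term. For \<open>j = K\<close> the index
  set refers to the lowered entry \<open>a_K\<close> itself, which shifts \<open>l\<close> by
  one.\<close>

lemma fsum_step:
  assumes j: "j \<in> {1..K}" and "a 0 = 0"
    and concave: "2 * a j - a (j - 1) - (if j = K then a j else a (j + 1)) \<ge> 1"
  shows "fsum K a l = fsum K (a(j := a j - 1)) (if j = K then l - 1 else l) +
    qpow (int j - a j) * fsum K (\<lambda>i. a i - 2 * int (min i j)) l"
proof -
  let ?a2 = "\<lambda>i. a i - 2 * int (min i j)"
  have "(\<Sum>m\<in>findex K a l. if m j = 0 then 0 else fsummand K ?a2 (m(j := m j - 1))) =
      (\<Sum>m\<in>{m \<in> findex K a l. m j \<noteq> 0}. fsummand K ?a2 (m(j := m j - 1)))"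
    by (intro sum.mono_neutral_cong_right finite_findex) auto
  also have "\<dots> = fsum K ?a2 l"
    unfolding fsum_def
  proof (intro sum.reindex_bij_witness [where j = "\<lambda>m. m(j := m j - 1)" and i = "\<lambda>m. m(j := Suc (m j))"])
    fix m assume "m \<in> {m \<in> findex K a l. m j \<noteq> 0}"
    then have m: "m \<in> findex K a l" "m j \<noteq> 0" by auto
    then show eq: "(m(j := m j - 1))(j := Suc ((m(j := m j - 1)) j)) = m" by simp
    show "m(j := m j - 1) \<in> findex K ?a2 l"
      using m j min_sum_upd [OF j, of "m(j := m j - 1)" K] unfolding eq
      by (auto simp: findex_def PiE_iff extensional_def)
  next
    fix m assume "m \<in> findex K ?a2 l"
    then show "m(j := Suc (m j)) \<in> {m \<in> findex K a l. m j \<noteq> 0}"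
      using j by (auto simp: findex_def PiE_iff extensional_def min_sum_upd)
  qed auto
  finally have *: "(\<Sum>m\<in>findex K a l. if m j = 0 then 0 else fsummand K ?a2 (m(j := m j - 1))) = fsum K ?a2 l" .
  have "findex K (a(j := a j - 1)) (if j = K then l - 1 else l) = findex K a l"
    by (auto simp: findex_def)
  then show ?thesis
    unfolding fsum_def [of K a] * [symmetric] fsummand_step [of j K a, OF assms]
    by (simp add: fsum_def sum.distrib sum_distrib_left)
qed

text \<open>From \<open>2 K m_K <= 2 (A m)_K = a_K - l < 2 K\<close> follows \<open>m_K = 0\<close>,
  so only one term of q-Pascal at \<open>K\<close> survives. Here \<open>K\<close> has to be large
  compared with \<open>a_K\<close>.\<close>

lemma fsum_drop_last:
  assumes "K \<ge> 1" "a K \<le> 2 * int K" "l > 0"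
  shows "fsum K a l = fsum K (a(K := a K - 1)) (l - 1)"
proof -
  have "findex K (a(K := a K - 1)) (l - 1) = findex K a l"
    by (auto simp: findex_def)
  moreover have "fsummand K a m = fsummand K (a(K := a K - 1)) m" if "m \<in> findex K a l" for m
  proof -
    have l: "a K - 2 * min_sum K m K = l"
      using that by (simp add: findex_def)
    have "int K * int (m K) \<le> min_sum K m K"
      using min_sum_ge [of K K K m] assms by simp
    then have "int K * int (m K) < int K * 1"
      using l assms by linarith
    then have "m K = 0"
      by (simp only: mult_less_cancel_left) auto
    then show ?thesis
      using fsummand_pascal [of K K m a] assms l by simp
  qed
  ultimately show ?thesis by (simp add: fsum_def)
qed

text \<open>For \<open>a = A (n + e_k)\<close> with \<open>n\<close> supported on
  \<open>{1..k}\<close>, the sums on the left belong to \<open>n + e_{k+1}\<close> and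
  \<open>n + e_{k-1}\<close>. In the first, the threshold of the added step is moved by q-Pascal
  from \<open>k + 1\<close> up past \<open>K\<close>, which leaves \<open>a\<close> at
  \<open>l - 1\<close>. Conversely, \<open>fsum_drop_last\<close> turns \<open>a\<close> at
  \<open>l + 1\<close> into a subtracted step at \<open>K\<close>, whose threshold is moved down to
  \<open>k\<close>. The remainders of both chains agree.\<close>

lemma fsum_exchange:
  assumes k: "1 \<le> k" "k < K" and a0: "a 0 = 0" and const: "\<And>i. k \<le> i \<Longrightarrow> a i = a k"
    and mono: "a (k - 1) \<le> a k" and large: "a k \<le> 2 * int K" and "l \<ge> 0"
  shows "fsum K (\<lambda>i. a i + of_bool (i \<ge> k + 1)) l + fsum K (\<lambda>i. a i - of_bool (i \<ge> k)) l =
    fsum K a (l - 1) + fsum K a (l + 1)"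
proof -
  \<comment> \<open>The remainder at threshold \<open>j\<close>: since \<open>min i j\<close> is
    \<open>min i (j - 1)\<close> plus the indicator of \<open>i >= j\<close>, moving the threshold
    of \<open>?x\<close> from \<open>j\<close> to \<open>j + 1\<close> and that of \<open>?y\<close>
    from \<open>j\<close> to \<open>j - 1\<close> leaves the same term.\<close>
  define E where "E j = qpow (int j - 1 - a k) * fsum K (\<lambda>i. a i - of_bool (i \<ge> j) - 2 * int (min i (j - 1))) l" for j
  let ?x = "\<lambda>j i. a i + of_bool (i \<ge> j)" and ?y = "\<lambda>j i. a i - of_bool (i \<ge> j + 1)"
  have x_step: "fsum K (?x j) l = fsum K ((?x j)(j := a j)) (if j = K then l - 1 else l) + E j"
    if "j \<in> {k + 1..K}" for j
  proof -
    have a: "a j = a k" "a (j - 1) = a k" "a (j + 1) = a k"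
      using that by (auto intro!: const)
    have eq: "(\<lambda>i. ?x j i - 2 * int (min i j)) = (\<lambda>i. a i - of_bool (i \<ge> j) - 2 * int (min i (j - 1)))"
      using that by (auto simp: fun_eq_iff of_bool_def min_def)
    have "fsum K (?x j) l = fsum K ((?x j)(j := ?x j j - 1)) (if j = K then l - 1 else l) +
        qpow (int j - ?x j j) * fsum K (\<lambda>i. ?x j i - 2 * int (min i j)) l"
      using that a by (intro fsum_step) (auto simp: a0)
    then show ?thesis
      unfolding E_def eq using a by (simp add: algebra_simps)
  qed
  have x: "fsum K (?x j) l = fsum K a (l - 1) + (\<Sum>i=j..K. E i)" if "j \<le> K" "k + 1 \<le> j" for j
    using that
  proof (induction j rule: inc_induct)
    case base
    have "fsum K ((?x K)(K := a K)) (l - 1) = fsum K a (l - 1)"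
      using k by (intro fsum_cong) auto
    then show ?case using x_step [of K] base by simp
  next
    case (step j)
    have "(?x j)(j := a j) = ?x (Suc j)"
      by (auto simp: fun_eq_iff of_bool_def)
    moreover have "(\<Sum>i=j..K. E i) = E j + (\<Sum>i=Suc j..K. E i)"
      using step by (intro sum.atLeast_Suc_atMost) auto
    ultimately show ?case using x_step [of j] step by simp
  qed
  have y_step: "fsum K (?y j) l = fsum K (?y (j - 1)) l + E (j + 1)" if "k \<le> j" "j < K" for j
  proof -
    have a: "a j = a k" "a (j + 1) = a k" "a (j - 1) \<le> a k"
      using that mono const [of j] const [of "j + 1"] const [of "j - 1"] by (cases "j = k"; auto)+
    have eq: "(?y j)(j := ?y j j - 1) = ?y (j - 1)"
      using that k by (auto simp: fun_eq_iff of_bool_def)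
    have "fsum K (?y j) l = fsum K ((?y j)(j := ?y j j - 1)) (if j = K then l - 1 else l) +
        qpow (int j - ?y j j) * fsum K (\<lambda>i. ?y j i - 2 * int (min i j)) l"
      using that a k by (intro fsum_step) (auto simp: a0)
    then show ?thesis
      unfolding E_def eq using a that by simp
  qed
  have y: "fsum K (?y j) l = fsum K (?y (k - 1)) l + (\<Sum>i=k+1..j+1. E i)" if "k - 1 \<le> j" "j < K" for j
    using that
  proof (induction j rule: dec_induct)
    case base
    then show ?case using k by simp
  next
    case (step j)
    then show ?case using y_step [of "Suc j"] k by (simp add: algebra_simps)
  qed
  have "fsum K a (l + 1) = fsum K (a(K := a K - 1)) l"
    using fsum_drop_last [of K a "l + 1"] k large const [of K] \<open>l \<ge> 0\<close> by simp
  also have "\<dots> = fsum K (?y (K - 1)) l"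
    using k by (intro fsum_cong) auto
  also have "\<dots> = fsum K (?y (k - 1)) l + (\<Sum>i=k+1..K. E i)"
    using y [of "K - 1"] k by simp
  finally show ?thesis
    using x [of "k + 1"] k by simp
qed

section \<open>Base cases, and the link with the truncated sum\<close>

lemma fsum_neg:
  assumes "K \<ge> 1" "l < 0"
  shows "fsum K a l = 0"
  unfolding fsum_def
proof (intro sum.neutral ballI)
  fix m assume "m \<in> findex K a l"
  then show "fsummand K a m = 0"
    using assms by (intro fsummand_eq_0 [of K]) (auto simp: findex_def)
qed

text \<open>A nonzero \<open>m\<close> has \<open>(A m)_1 >= 1\<close>, hence
  \<open>p_1 < 0\<close>; only \<open>m = 0\<close> can contribute.\<close>

lemma fsum_small:
  assumes "K \<ge> 1" "a 1 \<le> 1" "\<And>i. i \<in> {1..K} \<Longrightarrow> a i \<ge> 0"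
  shows "fsum K a l = (if l = a K then 1 else 0)"
proof -
  \<comment> \<open>The zero tuple as an extensional function, hence \<open>undefined\<close>
    outside \<open>{1..K}\<close>.\<close>
  let ?m0 = "\<lambda>i. if i \<in> {1..K} then 0 else undefined :: nat"
  have ms0: "min_sum K ?m0 i = 0" for i
    by (simp add: min_sum_def)
  have "fsummand K a m = 0" if "m \<in> findex K a l" "m \<noteq> ?m0" for m
  proof -
    obtain j where j': "m j \<noteq> ?m0 j"
      using \<open>m \<noteq> ?m0\<close> by blast
    moreover have "m j = undefined" if "j \<notin> {1..K}"
      using \<open>m \<in> findex K a l\<close> that by (auto simp: findex_def PiE_iff extensional_def)
    ultimately have j: "j \<in> {1..K}" "m j \<noteq> 0"
      by (auto split: if_splits)
    have "int (min 1 j) * int (m j) \<le> min_sum K m 1"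
      by (rule min_sum_ge) fact
    then have "min_sum K m 1 \<ge> 1"
      using j by (simp add: min_def split: if_splits)
    then show ?thesis
      using assms by (intro fsummand_eq_0 [of 1]) auto
  qed
  moreover have "?m0 \<in> findex K a l \<longleftrightarrow> l = a K"
    using ms0 by (auto simp: findex_def)
  moreover have "fsummand K a ?m0 = 1"
    unfolding fsummand_def ms0 using assms by (simp add: rbin_0_left)
  ultimately show ?thesis
  proof (cases "l = a K")
    case True
    then have "fsum K a l = (\<Sum>m\<in>{?m0}. fsummand K a m)"
      unfolding fsum_def using \<open>?m0 \<in> findex K a l \<longleftrightarrow> l = a K\<close> \<open>\<And>m. m \<in> findex K a l \<Longrightarrow> m \<noteq> ?m0 \<Longrightarrow> fsummand K a m = 0\<close>
      by (intro sum.mono_neutral_right finite_findex) auto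
    then show ?thesis using True \<open>fsummand K a ?m0 = 1\<close> by simp
  next
    case False
    then show ?thesis
      unfolding fsum_def using \<open>?m0 \<in> findex K a l \<longleftrightarrow> l = a K\<close> \<open>\<And>m. m \<in> findex K a l \<Longrightarrow> m \<noteq> ?m0 \<Longrightarrow> fsummand K a m = 0\<close>
      by (auto intro!: sum.neutral)
  qed
qed

text \<open>The conditions \<open>p_j >= 0\<close> leave the index set and are taken over by the
  zeros of \<open>rbin\<close>; under them \<open>rbin\<close> and \<open>qbin\<close>
  agree.\<close>

lemma M_trunc_eq_fsum:
  assumes "K \<ge> 1"
  shows "M_trunc K l n = fsum K (min_sum K n) (int l)"
proof -
  have p: "vac_p K n m j = min_sum K n j - 2 * min_sum K m j" for m j
    by (simp add: vac_p_def min_sum_def min.commute right_diff_distrib sum_subtractf sum_distrib_left mult.left_commute)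
  have q0: "vac_q0 K l n m = int l - (min_sum K n K - 2 * min_sum K m K)" for m
    by (simp add: vac_q0_def min_sum_beyond right_diff_distrib sum_subtractf sum_distrib_left mult.left_commute)
  have Q: "quad_Q K n m = (\<Sum>i=1..K. int (m i) * (min_sum K m i - min_sum K n i))" for m
    by (simp add: quad_Q_def min_sum_def right_diff_distrib sum_subtractf sum_distrib_left mult.assoc)
  have idx: "M_index K l n = {m \<in> findex K (min_sum K n) (int l). \<forall>j\<in>{1..K}. vac_p K n m j \<ge> 0}"
    by (auto simp: M_index_def findex_def q0)
  show ?thesis
    unfolding M_trunc_def fsum_def
  proof (intro sum.mono_neutral_cong_left finite_findex ballI)
    show "M_index K l n \<subseteq> findex K (min_sum K n) (int l)"
      unfolding idx by blast
  next
    fix m assume "m \<in> findex K (min_sum K n) (int l) - M_index K l n"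
    then obtain j where "j \<in> {1..K}" "vac_p K n m j < 0"
      unfolding idx by (auto simp: not_le)
    then show "fsummand K (min_sum K n) m = 0"
      by (intro fsummand_eq_0 [of j]) (simp_all add: p)
  next
    fix m assume "m \<in> M_index K l n"
    then have "vac_p K n m j \<ge> 0" if "j \<in> {1..K}" for j
      using that unfolding idx by blast
    then show "qpow (quad_Q K n m) * (\<Prod>i=1..K. qbin (m i) (vac_p K n m i)) = fsummand K (min_sum K n) m"
      unfolding fsummand_def Q by (intro arg_cong2 [where f = "(*)"] prod.cong) (simp_all add: rbin_def p)
  qed
qed


section \<open>The quantum Q-system\<close>

lemma torus_of_tpow [simp]: "torus_of (tpow k) = tor k 0 0"
  by (simp add: torus_of_def tpow_def tor_def)

lemma torus_of_uminus: "torus_of (- x) = - torus_of x"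
  by (simp add: torus_of_def frag_extend_minus)

lemma torus_of_1 [simp]: "torus_of 1 = 1"
  using torus_of_tpow [of 0] by (simp add: tor_one tpow_def)

lemma tor_scalar_commute: "x * tor c 0 0 = tor c 0 0 * x"
  using subset_UNIV [of "Poly_Mapping.keys x"]
proof (induction x rule: frag_induction)
  case (one x)
  then show ?case by (cases x) (simp add: tor_def mult_single add.commute)
qed (simp_all add: algebra_simps)

lemma tor_scalar_left_commute: "x * (tor c 0 0 * y) = tor c 0 0 * (x * y)"
  by (metis mult.assoc tor_scalar_commute)

lemma tor_scalar_collect: "tor c 0 0 * (tor d 0 0 * x) = tor (c + d) 0 0 * x"
  by (simp add: tor_mult flip: mult.assoc)

text \<open>The index is shifted by one: \<open>qsol n\<close> is \<open>Q\<^bsub>n - 1\<^esub>\<close>.\<close>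

definition cons_C :: qtorus where
  "cons_C = tor 1 (-1) 1 + tor 1 1 (-1) - tor (-1) (-1) (-1)"

text \<open>The initial values are \<open>Q_{-1} = t^{-1} Q_1^{-1} (Q_0^2 - 1)\<close> and
  \<open>Q_0\<close>. The linear recursion stays inside the torus by construction, whereas the
  quadratic one would call for a division.\<close>

fun qsol :: "nat \<Rightarrow> qtorus" where
  "qsol 0 = tor 1 2 (-1) - tor (-1) 0 (-1)"
| "qsol (Suc 0) = tor 0 1 0"
| "qsol (Suc (Suc n)) = tor (-1) 0 0 * (qsol (Suc n) * cons_C - qsol n)"

text \<open>\<open>cons_C\<close> is \<open>Q_0^{-1} (t Q_1 + Q_{-1})\<close> multiplied out, so the
  recursion returns \<open>Q_1\<close>.\<close>

lemma qsol_2: "qsol (Suc (Suc 0)) = tor 0 0 1"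
  by (simp add: cons_C_def algebra_simps tor_mult)

lemma qsol_C: "qsol (Suc n) * cons_C = tor 1 0 0 * qsol (Suc (Suc n)) + qsol n"
  by (simp add: tor_scalar_collect tor_one)

text \<open>The linear recursion with \<open>C\<close> on the left, where \<open>t\<close> moves to
  the other term. Two initial cases are computed; afterwards \<open>C (Q_j C) = (C Q_j) C\<close>
  carries the relation along.\<close>

lemma C_qsol: "cons_C * qsol (Suc n) = qsol (Suc (Suc n)) + tor 1 0 0 * qsol n"
proof (induction n rule: induct_nat_012)
  case 0
  show ?case by (simp add: qsol_2 cons_C_def algebra_simps tor_mult del: qsol.simps(3))
next
  case 1
  show ?case by (simp add: qsol_2 cons_C_def algebra_simps tor_mult)
next
  case (ge2 n)
  have "tor 1 0 0 * (cons_C * qsol (Suc (Suc (Suc n)))) =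
      cons_C * (qsol (Suc (Suc n)) * cons_C) - cons_C * qsol (Suc n)"
    by (simp add: qsol_C algebra_simps tor_scalar_left_commute del: qsol.simps(3))
  also have "\<dots> = (qsol (Suc (Suc (Suc n))) + tor 1 0 0 * qsol (Suc n)) * cons_C - (qsol (Suc (Suc n)) + tor 1 0 0 * qsol n)"
    by (simp add: ge2 flip: mult.assoc del: qsol.simps(3))
  also have "\<dots> = tor 1 0 0 * (qsol (Suc (Suc (Suc (Suc n)))) + tor 1 0 0 * qsol (Suc (Suc n)))"
    by (simp add: qsol_C algebra_simps del: qsol.simps(3))
  finally have "tor (-1) 0 0 * (tor 1 0 0 * (cons_C * qsol (Suc (Suc (Suc n))))) =
      tor (-1) 0 0 * (tor 1 0 0 * (qsol (Suc (Suc (Suc (Suc n)))) + tor 1 0 0 * qsol (Suc (Suc n))))"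
    by simp
  then show ?case by (simp only: tor_scalar_collect) (simp add: tor_one del: qsol.simps(3))
qed

text \<open>In \<open>Q_a C Q_b\<close> the factor \<open>C\<close> is absorbed to the left or to
  the right. Hence \<open>t Q_{a+1} Q_b - Q_a Q_{b+1}\<close> depends only on \<open>a - b\<close>;
  the differences \<open>0\<close>, \<open>1\<close>, \<open>-1\<close> and \<open>-2\<close> give
  the four relations that follow.\<close>

lemma qsol_exchange:
  "tor 1 0 0 * (qsol (Suc (Suc a)) * qsol (Suc b)) - qsol (Suc a) * qsol (Suc (Suc b)) =
   tor 1 0 0 * (qsol (Suc a) * qsol b) - qsol a * qsol (Suc b)"
proof -
  have "(qsol (Suc a) * cons_C) * qsol (Suc b) = qsol (Suc a) * (cons_C * qsol (Suc b))"
    by (rule mult.assoc)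
  then show ?thesis
    unfolding qsol_C C_qsol by (simp add: algebra_simps tor_scalar_left_commute del: qsol.simps(3))
qed

lemma qsol_commute: "qsol a * qsol (Suc a) = tor 1 0 0 * (qsol (Suc a) * qsol a)"
proof (induction a)
  case 0
  show ?case by (simp add: algebra_simps tor_mult)
next
  case (Suc a)
  then show ?case using qsol_exchange [of a a] by (simp del: qsol.simps)
qed

lemma qsol_quadratic: "tor 1 0 0 * (qsol (Suc (Suc a)) * qsol a) = qsol (Suc a) * qsol (Suc a) - 1"
proof (induction a)
  case 0
  show ?case unfolding qsol_2 by (simp add: algebra_simps tor_mult flip: tor_one)
next
  case (Suc a)
  then show ?case using qsol_exchange [of "Suc a" a] by (simp add: diff_eq_eq del: qsol.simps)
qed

lemma qsol_quadratic': "tor 1 0 0 * (qsol (Suc a) * qsol (Suc a)) = qsol a * qsol (Suc (Suc a)) + tor (-1) 0 0"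
proof (induction a)
  case 0
  show ?case unfolding qsol_2 by (simp add: algebra_simps tor_mult flip: tor_one)
next
  case (Suc a)
  then show ?case using qsol_exchange [of a "Suc a"] by (simp add: algebra_simps del: qsol.simps)
qed

text \<open>For \<open>a >= 1\<close> this expresses \<open>C\<close> through \<open>Q_j\<close>
  with \<open>j >= 0\<close>, which will place it in \<open>A_plus\<close>.\<close>

lemma cons_C_eq:
  "tor 1 0 0 * (qsol (Suc a) * qsol (Suc (Suc a))) - qsol a * qsol (Suc (Suc (Suc a))) = tor (-2) 0 0 * cons_C"
proof (induction a)
  case 0
  show ?case unfolding qsol.simps(3)[of "Suc 0"] qsol_2
    by (simp add: algebra_simps tor_mult cons_C_def)
next
  case (Suc a)
  then show ?case using qsol_exchange [of a "Suc (Suc a)"] by (simp del: qsol.simps)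
qed

section \<open>Degree in \<open>Q_1\<close> and cancellation in the quantum torus\<close>

fun bdeg :: "tmon \<Rightarrow> int" where
  "bdeg (TMon c a b) = b"

lemma bdeg_add: "bdeg (x + y) = bdeg x + bdeg y"
  by (cases x; cases y) simp

definition below_deg :: "int \<Rightarrow> qtorus \<Rightarrow> bool" where
  "below_deg n x \<longleftrightarrow> (\<forall>k\<in>Poly_Mapping.keys x. bdeg k < n)"

text \<open>The part of top degree is a single monomial, hence a unit.\<close>

definition monic_deg :: "int \<Rightarrow> qtorus \<Rightarrow> bool" where
  "monic_deg n x \<longleftrightarrow> (\<exists>c a. below_deg n (x - tor c a n))"

lemma keys_tor: "Poly_Mapping.keys (tor c a b) = {TMon c a b}"
  by (simp add: tor_def)

lemma below_deg_tor [simp]: "below_deg n (tor c a b) \<longleftrightarrow> b < n"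
  by (simp add: below_deg_def keys_tor)

lemma below_deg_add: "below_deg n x \<Longrightarrow> below_deg n y \<Longrightarrow> below_deg n (x + y)"
  using keys_add [of x y] by (auto simp: below_deg_def)

lemma below_deg_uminus: "below_deg n x \<Longrightarrow> below_deg n (- x)"
  by (auto simp: below_deg_def)

lemma below_deg_diff: "below_deg n x \<Longrightarrow> below_deg n y \<Longrightarrow> below_deg n (x - y)"
  using below_deg_add [of n x "- y"] below_deg_uminus [of n y] by simp

lemma below_deg_mult: "below_deg n x \<Longrightarrow> below_deg (m + 1) y \<Longrightarrow> below_deg (n + m) (x * y)"
  unfolding below_deg_def
proof
  fix k
  assume x: "\<forall>k\<in>Poly_Mapping.keys x. bdeg k < n" and y: "\<forall>k\<in>Poly_Mapping.keys y. bdeg k < m + 1"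
    and "k \<in> Poly_Mapping.keys (x * y)"
  then obtain u v where "k = u + v" "u \<in> Poly_Mapping.keys x" "v \<in> Poly_Mapping.keys y"
    using keys_mult [of x y] by blast
  then show "bdeg k < n + m"
    using x [rule_format, of u] y [rule_format, of v] by (simp add: bdeg_add)
qed

lemma below_deg_mult': "below_deg (n + 1) x \<Longrightarrow> below_deg m y \<Longrightarrow> below_deg (n + m) (x * y)"
  unfolding below_deg_def
proof
  fix k
  assume x: "\<forall>k\<in>Poly_Mapping.keys x. bdeg k < n + 1" and y: "\<forall>k\<in>Poly_Mapping.keys y. bdeg k < m"
    and "k \<in> Poly_Mapping.keys (x * y)"
  then obtain u v where "k = u + v" "u \<in> Poly_Mapping.keys x" "v \<in> Poly_Mapping.keys y"
    using keys_mult [of x y] by blast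
  then show "bdeg k < n + m"
    using x [rule_format, of u] y [rule_format, of v] by (simp add: bdeg_add)
qed

lemma below_deg_mono: "below_deg n x \<Longrightarrow> n \<le> m \<Longrightarrow> below_deg m x"
  by (force simp: below_deg_def)

lemma monic_deg_below: "monic_deg n x \<Longrightarrow> below_deg (n + 1) x"
proof -
  assume "monic_deg n x"
  then obtain c a where "below_deg n (x - tor c a n)" by (auto simp: monic_deg_def)
  then have "below_deg (n + 1) (x - tor c a n + tor c a n)"
    by (intro below_deg_add) (auto intro: below_deg_mono)
  then show ?thesis by simp
qed

lemma monic_deg_tor: "monic_deg n (tor c a n)"
  unfolding monic_deg_def by (rule exI [of _ c], rule exI [of _ a]) (simp add: below_deg_def)

lemma monic_deg_mult:
  assumes "monic_deg n x" "monic_deg m y"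
  shows "monic_deg (n + m) (x * y)"
proof -
  obtain c a c' a' where x: "below_deg n (x - tor c a n)" and y: "below_deg m (y - tor c' a' m)"
    using assms by (auto simp: monic_deg_def)
  have "x * y - tor c a n * tor c' a' m = (x - tor c a n) * y + tor c a n * (y - tor c' a' m)"
    by (simp add: algebra_simps)
  also have "below_deg (n + m) \<dots>"
    using x y monic_deg_below [OF assms(2)]
    by (intro below_deg_add below_deg_mult below_deg_mult') auto
  finally show ?thesis
    unfolding tor_mult monic_deg_def by blast
qed

lemma monic_deg_diff: "monic_deg n x \<Longrightarrow> below_deg n y \<Longrightarrow> monic_deg n (x - y)"
proof -
  assume "monic_deg n x" and y: "below_deg n y"
  then obtain c a where "below_deg n (x - tor c a n)" by (auto simp: monic_deg_def)
  then have "below_deg n (x - tor c a n - y)"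
    using y by (rule below_deg_diff)
  moreover have "x - tor c a n - y = x - y - tor c a n"
    by simp
  ultimately have "below_deg n (x - y - tor c a n)"
    by simp
  then show ?thesis by (auto simp: monic_deg_def)
qed

lemma monic_deg_qsol: "monic_deg (int n) (qsol (Suc n))"
proof (induction n rule: induct_nat_012)
  case 0
  show ?case using monic_deg_tor [of 0] by simp
next
  case 1
  show ?case unfolding qsol_2 using monic_deg_tor [of 1] by simp
next
  case (ge2 n)
  have C: "monic_deg 1 cons_C"
    unfolding monic_deg_def cons_C_def
    by (rule exI [of _ 1], rule exI [of _ "-1"]) (simp add: below_deg_diff)
  have "monic_deg (0 + ((int (Suc n) + 1))) (qsol (Suc (Suc (Suc n))))"
    unfolding qsol.simps(3) [of "Suc n"]
    using ge2 C by (intro monic_deg_mult monic_deg_diff monic_deg_tor below_deg_mono [OF monic_deg_below [OF ge2(1)]]) auto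
  then show ?case by (simp add: add.commute del: qsol.simps)
qed

text \<open>If \<open>z\<close> has degree \<open>d\<close>, then \<open>z x = 0\<close> pushes the
  product of \<open>z\<close> with the leading monomial of \<open>x\<close> below degree
  \<open>d + n\<close>. Multiplying by the inverse monomial pushes \<open>z\<close> below degree
  \<open>d\<close>.\<close>

lemma monic_deg_cancel:
  assumes "monic_deg n x" "z * x = 0"
  shows "z = 0"
proof (rule ccontr)
  assume "z \<noteq> 0"
  obtain c a where x: "below_deg n (x - tor c a n)"
    using assms(1) by (auto simp: monic_deg_def)
  define d where "d = Max (bdeg ` Poly_Mapping.keys z)"
  have "Poly_Mapping.keys z \<noteq> {}"
    using \<open>z \<noteq> 0\<close> by simp
  then have "d \<in> bdeg ` Poly_Mapping.keys z"
    unfolding d_def by (intro Max_in finite_imageI finite_keys) blast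
  then obtain k where k: "k \<in> Poly_Mapping.keys z" "bdeg k = d" by blast
  have "bdeg u \<le> d" if "u \<in> Poly_Mapping.keys z" for u
    unfolding d_def using that by (intro Max_ge) auto
  then have "below_deg (d + 1) z"
    by (simp add: below_deg_def zle_add1_eq_le)
  then have "below_deg (d + n) (z * (x - tor c a n))"
    by (rule below_deg_mult') fact
  moreover have "z * (x - tor c a n) = - (z * tor c a n)"
    unfolding right_diff_distrib assms(2) by (rule diff_0)
  ultimately have "below_deg (d + n) (z * tor c a n)"
    using below_deg_uminus [of "d + n" "- (z * tor c a n)"] unfolding minus_minus by metis
  then have "below_deg (d + n + (- n)) (z * tor c a n * tor (- c - a * n) (- a) (- n))"
    by (rule below_deg_mult) simp
  then have "below_deg d z"
    by (simp add: mult.assoc tor_mult tor_one)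
  then show False
    using k by (auto simp: below_deg_def)
qed

text \<open>The quadratic relation determines \<open>Q_{j+1}\<close> from \<open>Q_j\<close> and
  \<open>Q_{j-1}\<close>, since \<open>Q_{j-1}\<close> has an invertible leading monomial and
  cancels on the right.\<close>

lemma quantum_Q_system_unique:
  assumes "quantum_Q_system Q"
  shows "Q (int n) = qsol (Suc n)"
proof (induction n rule: induct_nat_012)
  case 0
  have "Q 0 = tor 0 1 0" using assms unfolding quantum_Q_system_def by blast
  then show ?case by simp
next
  case 1
  have "Q 1 = tor 0 0 1" using assms unfolding quantum_Q_system_def by blast
  then show ?case by (simp add: qsol_2 del: qsol.simps)
next
  case (ge2 n)
  have "tor 1 0 0 * Q (int (Suc n) + 1) * Q (int (Suc n) - 1) = Q (int (Suc n)) ^ 2 - 1"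
    using assms by (simp only: quantum_Q_system_def torus_of_tpow)
  then have "tor 1 0 0 * (Q (int (Suc (Suc n))) * qsol (Suc n)) = tor 1 0 0 * (qsol (Suc (Suc (Suc n))) * qsol (Suc n))"
    unfolding qsol_quadratic using ge2 by (simp add: power2_eq_square mult.assoc algebra_simps del: qsol.simps)
  then have "tor (-1) 0 0 * (tor 1 0 0 * (Q (int (Suc (Suc n))) * qsol (Suc n))) = tor (-1) 0 0 * (tor 1 0 0 * (qsol (Suc (Suc (Suc n))) * qsol (Suc n)))"
    by simp
  then have "(Q (int (Suc (Suc n))) - qsol (Suc (Suc (Suc n)))) * qsol (Suc n) = 0"
    by (simp only: tor_scalar_collect) (simp add: tor_one left_diff_distrib del: qsol.simps)
  then show ?case
    using monic_deg_cancel [OF monic_deg_qsol] by fastforce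
qed


section \<open>The action on the cyclic vector\<close>

declare qsol.simps [simp del]

lemma tpow_eq_iff: "tpow a = tpow b \<longleftrightarrow> a = b"
  by (auto simp: tpow_def) (metis lookup_single_eq lookup_single_not_eq one_neq_zero)

lemma tpow_nonzero: "tpow a \<noteq> 0"
  by (simp add: tpow_def)

locale Q_rep = cyclic_right_rep scale Q act bra
  for scale :: "laurent \<Rightarrow> 'v::ab_group_add \<Rightarrow> 'v"
    and Q :: "int \<Rightarrow> qtorus" and act :: "'v \<Rightarrow> qtorus \<Rightarrow> 'v" and bra :: "nat \<Rightarrow> 'v" +
  fixes ket :: "nat \<Rightarrow> 'v \<Rightarrow> laurent"
  assumes Q_system: "quantum_Q_system Q"
    and dual: "dual_basis scale bra ket"
begin

abbreviation "A \<equiv> A_plus Q"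

lemma tor_scalar_A [simp]: "tor c 0 0 \<in> A"
  using A_plus.scalar [of "tpow c" Q] by simp

lemma uminus_A: "x \<in> A \<Longrightarrow> - x \<in> A"
  using A_plus.mult [OF A_plus.scalar [of "-1"], of x] by (simp add: torus_of_uminus)

lemma diff_A: "x \<in> A \<Longrightarrow> y \<in> A \<Longrightarrow> x - y \<in> A"
  using A_plus.add [OF _ uminus_A, of x y] by simp

lemma power_A: "x \<in> A \<Longrightarrow> x ^ n \<in> A"
  using A_plus.scalar [of 1 Q] by (induction n) (simp_all add: A_plus.mult)

lemma qsol_Suc_A: "qsol (Suc n) \<in> A"
  using A_plus.Qm [of "int n" Q] A_plus.Q0 [of Q] quantum_Q_system_unique [OF Q_system, of n]
  by (cases "n = 0") auto

text \<open>As defined, \<open>C\<close> involves \<open>Q_1^{-1}\<close>, which is not among the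
  generators; \<open>cons_C_eq\<close> writes it with \<open>Q_0, ..., Q_3\<close>.\<close>

lemma cons_C_A [simp]: "cons_C \<in> A"
proof -
  have "cons_C = tor 2 0 0 * (tor (-2) 0 0 * cons_C)"
    by (simp add: tor_scalar_collect tor_one)
  also have "\<dots> \<in> A"
    unfolding cons_C_eq [of "Suc 0", symmetric] by (intro A_plus.mult diff_A qsol_Suc_A tor_scalar_A)
  finally show ?thesis .
qed

lemma qsol_A [simp]: "qsol n \<in> A"
proof (cases n)
  case 0
  have "qsol 0 = qsol (Suc 0) * cons_C - tor 1 0 0 * qsol (Suc (Suc 0))"
    by (simp add: qsol_C)
  then show ?thesis
    unfolding 0 by (metis qsol_Suc_A cons_C_A A_plus.mult diff_A tor_scalar_A)
qed (use qsol_Suc_A in simp)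

lemma act_tor: "act v (tor c 0 0) = scale (tpow c) v"
  using act_scalar [of v "tpow c"] by simp

lemma act_tor_mult: "x \<in> A \<Longrightarrow> act v (tor c 0 0 * x) = scale (tpow c) (act v x)"
  by (simp add: act_mult act_scale_left act_tor)

lemma act_diff: "x \<in> A \<Longrightarrow> y \<in> A \<Longrightarrow> act v (x - y) = act v x - act v y"
  using act_add_right [OF diff_A, of x y y v] by (simp add: eq_diff_eq)

lemma act_0_left: "x \<in> A \<Longrightarrow> act 0 x = 0"
  using act_scale_left [of x 0 0] by simp

lemma act_1: "act v 1 = v"
  using act_scalar [of v 1] by simp

section \<open>Coordinates with respect to the dual basis\<close>

lemma ket_add: "ket l (v + w) = ket l v + ket l w"
  using dual module_hom.add [of scale "(*)" "ket l"] by (simp add: dual_basis_def)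

lemma ket_scale: "ket l (scale c v) = c * ket l v"
  using dual module_hom.scale [of scale "(*)" "ket l"] by (simp add: dual_basis_def)

lemma ket_diff: "ket l (v - w) = ket l v - ket l w"
  using ket_add [of l "v - w" w] by simp

lemma ket_0: "ket l 0 = 0"
  using ket_scale [of l 0 0] by simp

lemma ket_sum: "ket l (sum f I) = (\<Sum>i\<in>I. ket l (f i))"
  by (induction I rule: infinite_finite_induct) (simp_all add: ket_add ket_0)

lemma ket_bra: "ket l (bra m) = (if m = l then 1 else 0)"
  using dual by (simp add: dual_basis_def)

lemma ket_separates:
  assumes "\<And>l. ket l v = 0"
  shows "v = 0"
proof -
  have "v \<in> span (range bra)" by (simp add: span_bra)
  then obtain t r where t: "finite t" "t \<subseteq> range bra" "v = (\<Sum>a\<in>t. scale (r a) a)"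
    unfolding span_explicit by blast
  have "r (bra m) = 0" if "bra m \<in> t" for m
  proof -
    have "ket m a = (if a = bra m then 1 else 0)" if "a \<in> t" for a
      using that t(2) inj_bra by (auto simp: ket_bra inj_def)
    then have "ket m v = (\<Sum>a\<in>t. if a = bra m then r a else 0)"
      unfolding t(3) ket_sum ket_scale by (intro sum.cong) auto
    also have "\<dots> = r (bra m)"
      using that t(1) by simp
    finally show ?thesis using assms by simp
  qed
  then have "\<And>a. a \<in> t \<Longrightarrow> scale (r a) a = 0"
    using t(2) by auto
  then show ?thesis
    unfolding t(3) by (rule sum.neutral [OF ballI])
qed

text \<open>Coordinates lie in an integral domain, so the module is torsion free.\<close>

lemma scale_eq_0: "scale c v = 0 \<Longrightarrow> c = 0 \<or> v = 0"
  using ket_separates [of v] ket_scale [of _ c v] ket_0 by (metis mult_eq_0_iff)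

lemma ket_finite: "\<exists>M. \<forall>m>M. ket m v = 0"
proof -
  have "v \<in> span (range bra)" by (simp add: span_bra)
  then show ?thesis
  proof (induction rule: span_induct_alt)
    case base
    then show ?case by (simp add: ket_0)
  next
    case (step c x y)
    then obtain j M where "x = bra j" "\<forall>m>M. ket m y = 0" by blast
    then have "\<forall>m>max j M. ket m (scale c x + y) = 0"
      by (auto simp: ket_add ket_scale ket_bra)
    then show ?case by blast
  qed
qed

lemma ket_expand:
  assumes "\<And>m. m > M \<Longrightarrow> ket m v = 0"
  shows "v = (\<Sum>m\<le>M. scale (ket m v) (bra m))"
proof -
  have "ket l (v - (\<Sum>m\<le>M. scale (ket m v) (bra m))) = 0" for l
  proof -
    have "(\<Sum>m\<le>M. ket m v * ket l (bra m)) = (\<Sum>m\<le>M. if m = l then ket l v else 0)"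
      by (intro sum.cong) (auto simp: ket_bra)
    also have "\<dots> = ket l v"
      using assms [of l] by (auto simp: not_le)
    finally show ?thesis
      by (simp add: ket_diff ket_sum ket_scale)
  qed
  then show ?thesis using ket_separates [of "v - (\<Sum>m\<le>M. scale (ket m v) (bra m))"] by simp
qed

text \<open>\<open>wvec i\<close> has weight \<open>t\<^bsup>-i\<^esup>\<close> for \<open>Q\<^sub>0\<close>. Since \<open>\<langle>m|\<close> has a nonzero component along \<open>wvec (m + 1)\<close> and
  all others at lower indices, \<open>wvec 0 = \<langle>0|Q\<^bsub>-1\<^esub>\<close> can be a combination of the \<open>\<langle>m|\<close> only if it vanishes.\<close>

definition wvec :: "int \<Rightarrow> 'v" where
  "wvec i = (if i \<ge> 1 then act (bra 0) (qsol 2 ^ nat (i - 1)) else act (bra 0) (qsol 0 ^ nat (1 - i)))"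

abbreviation wspan :: "int \<Rightarrow> 'v set" where
  "wspan r \<equiv> span (wvec ` {..r})"

section \<open>Weight vectors of \<open>Q_0\<close> and triangularity of the basis\<close>

lemma wvec_1: "wvec 1 = bra 0"
  by (simp add: wvec_def act_1)

lemma wvec_up: "i \<ge> 1 \<Longrightarrow> act (wvec i) (qsol 2) = wvec (i + 1)"
proof -
  assume "i \<ge> 1"
  then have "nat (i + 1 - 1) = Suc (nat (i - 1))" by simp
  then show ?thesis
    using \<open>i \<ge> 1\<close> by (simp add: wvec_def power_A power_Suc2 act_mult [symmetric] del: power_Suc)
qed

lemma wvec_down: "i \<le> 1 \<Longrightarrow> act (wvec i) (qsol 0) = wvec (i - 1)"
proof -
  assume i: "i \<le> 1"
  then have "nat (1 - (i - 1)) = Suc (nat (1 - i))" by simp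
  then show ?thesis
    using i by (cases "i = 1") (simp_all add: wvec_def power_A power_Suc2 act_1 act_mult [symmetric] del: power_Suc)
qed

text \<open>\<open>bra 0\<close> has weight \<open>t^{-1}\<close>, and
  \<open>Q_1 Q_0 = t^{-1} Q_0 Q_1\<close>, \<open>Q_{-1} Q_0 = t Q_0 Q_{-1}\<close>.\<close>

lemma wvec_weight: "act (wvec i) (qsol (Suc 0)) = scale (tpow (- i)) (wvec i)"
proof (cases "i \<ge> 1")
  case True
  then show ?thesis
  proof (induction i rule: int_ge_induct)
    case base
    show ?case
      using bra_0 quantum_Q_system_unique [OF Q_system, of 0] by (simp add: wvec_1)
  next
    case (step i)
    have "qsol 2 * qsol (Suc 0) = tor (-1) 0 0 * (qsol (Suc 0) * qsol 2)"
      using qsol_commute [of 1] by (simp add: numeral_2_eq_2 tor_scalar_collect tor_one)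
    then have "act (wvec (i + 1)) (qsol (Suc 0)) = act (wvec i) (tor (-1) 0 0 * (qsol (Suc 0) * qsol 2))"
      using wvec_up [of i] step.hyps by (metis act_mult qsol_A)
    also have "\<dots> = scale (tpow (-1)) (scale (tpow (- i)) (wvec (i + 1)))"
      using wvec_up [of i] step by (simp add: act_tor A_plus.mult act_mult act_scale_left)
    also have "\<dots> = scale (tpow (- (i + 1))) (wvec (i + 1))"
      by (simp add: algebra_simps flip: tpow_add)
    finally show ?case .
  qed
next
  case False
  then have "i \<le> 1" by simp
  then show ?thesis
  proof (induction i rule: int_le_induct)
    case base
    show ?case
      using bra_0 quantum_Q_system_unique [OF Q_system, of 0] by (simp add: wvec_1)
  next
    case (step i)
    have "qsol 0 * qsol (Suc 0) = tor 1 0 0 * (qsol (Suc 0) * qsol 0)"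
      using qsol_commute [of 0] by (simp)
    then have "act (wvec (i - 1)) (qsol (Suc 0)) = act (wvec i) (tor 1 0 0 * (qsol (Suc 0) * qsol 0))"
      using wvec_down [of i] step.hyps by (metis act_mult qsol_A)
    also have "\<dots> = scale (tpow 1) (scale (tpow (- i)) (wvec (i - 1)))"
      using wvec_down [of i] step by (simp add: act_tor A_plus.mult act_mult act_scale_left)
    also have "\<dots> = scale (tpow (- (i - 1))) (wvec (i - 1))"
      by (simp add: algebra_simps flip: tpow_add)
    finally show ?case .
  qed
qed

lemma act_weight_square:
  "act (wvec i) (qsol (Suc 0) * qsol (Suc 0)) = scale (tpow (- 2 * i)) (wvec i)"
  by (simp add: act_mult wvec_weight act_scale_left flip: tpow_add)

text \<open>This undoes a step down: \<open>Q_{-1} Q_1 = t Q_0^2 - t^{-1}\<close> acts as a scalar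
  on each weight vector.\<close>

lemma wvec_up':
  assumes "i \<le> 0"
  shows "act (wvec i) (qsol 2) = scale (tpow 1 * tpow (- 2 * (i + 1)) - tpow (-1)) (wvec (i + 1))"
proof -
  have "qsol 0 * qsol 2 = tor 1 0 0 * (qsol (Suc 0) * qsol (Suc 0)) - tor (-1) 0 0"
    using qsol_quadratic' [of 0] by (simp add: numeral_2_eq_2)
  moreover have "act (wvec i) (qsol 2) = act (wvec (i + 1)) (qsol 0 * qsol 2)"
    using wvec_down [of "i + 1"] assms by (simp add: act_mult)
  ultimately show ?thesis
    by (simp only: act_diff act_tor_mult act_tor tor_scalar_A qsol_A A_plus.mult act_weight_square
        scale_left_diff_distrib scale_scale)
qed

lemma wvec_down':
  assumes "i \<ge> 2"
  shows "act (wvec i) (qsol 0) = scale (tpow (-1) * (tpow (- 2 * (i - 1)) - 1)) (wvec (i - 1))"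
proof -
  have "qsol 2 * qsol 0 = tor (-1) 0 0 * (tor 1 0 0 * (qsol 2 * qsol 0))"
    by (simp only: tor_scalar_collect) (simp add: tor_one)
  also have "\<dots> = tor (-1) 0 0 * (qsol (Suc 0) * qsol (Suc 0) - 1)"
    using qsol_quadratic [of 0] by (simp add: numeral_2_eq_2)
  finally have "qsol 2 * qsol 0 = tor (-1) 0 0 * (qsol (Suc 0) * qsol (Suc 0) - 1)" .
  moreover have "act (wvec i) (qsol 0) = act (wvec (i - 1)) (qsol 2 * qsol 0)"
    using wvec_up [of "i - 1"] assms by (simp add: act_mult)
  moreover have "1 \<in> A" using A_plus.scalar [of 1 Q] by simp
  ultimately show ?thesis
    by (simp only: act_diff diff_A act_tor_mult act_tor tor_scalar_A qsol_A A_plus.mult act_weight_square act_1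
        right_diff_distrib scale_left_diff_distrib scale_right_diff_distrib scale_scale scale_one mult_1_right)
qed

text \<open>\<open>Q_{-1}\<close> takes \<open>wvec (i + 1)\<close> back to \<open>wvec i\<close>
  times \<open>t^{-1} (t^{-2i} - 1)\<close>, which is nonzero for \<open>i >= 1\<close>.\<close>

lemma wvec_nonzero: "i \<ge> 1 \<Longrightarrow> wvec i \<noteq> 0"
proof (induction i rule: int_ge_induct)
  case base
  show ?case unfolding wvec_1 using ket_bra [of 0 0] ket_0 by auto
next
  case (step i)
  show ?case
  proof
    assume "wvec (i + 1) = 0"
    then have "scale (tpow (-1) * (tpow (- 2 * i) - 1)) (wvec i) = 0"
      using wvec_down' [of "i + 1"] step.hyps by (simp add: act_0_left)
    moreover have "tpow (- 2 * i) \<noteq> tpow 0"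
      unfolding tpow_eq_iff using step.hyps by simp
    ultimately show False
      using scale_eq_0 [of "tpow (-1) * (tpow (- 2 * i) - 1)" "wvec i"] step.IH tpow_nonzero by simp
  qed
qed

lemma wvec_in_wspan: "i \<le> r \<Longrightarrow> wvec i \<in> wspan r"
  by (auto intro: span_base)

lemma wspan_mono: "r \<le> s \<Longrightarrow> v \<in> wspan r \<Longrightarrow> v \<in> wspan s"
  by (rule subsetD [OF span_mono]) auto

text \<open>From \<open>Q_0 C = t Q_1 + Q_{-1}\<close>, where \<open>Q_0\<close> acts on
  \<open>wvec i\<close> by \<open>t^{-i}\<close>.\<close>

lemma wvec_C: "act (wvec i) cons_C = scale (tpow (i + 1)) (act (wvec i) (qsol 2)) + scale (tpow i) (act (wvec i) (qsol 0))"
proof -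
  have "qsol (Suc 0) * cons_C = tor 1 0 0 * qsol 2 + qsol 0"
    using qsol_C [of 0] by (simp add: numeral_2_eq_2)
  then have "scale (tpow (- i)) (act (wvec i) cons_C) = scale (tpow 1) (act (wvec i) (qsol 2)) + act (wvec i) (qsol 0)"
    by (metis A_plus.mult act_add_right act_mult act_scale_left act_tor_mult cons_C_A qsol_A tor_scalar_A wvec_weight)
  then have "scale (tpow i) (scale (tpow (- i)) (act (wvec i) cons_C)) =
      scale (tpow i) (scale (tpow 1) (act (wvec i) (qsol 2)) + act (wvec i) (qsol 0))"
    by simp
  then show ?thesis
    by (simp add: scale_right_distrib flip: tpow_add)
qed

lemma wvec_down_wspan: "act (wvec i) (qsol 0) \<in> wspan (i - 1)"
proof (cases "i \<ge> 2")
  case True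
  then show ?thesis by (simp only: wvec_down') (intro span_scale wvec_in_wspan, simp)
next
  case False
  then show ?thesis by (simp only: wvec_down) (intro wvec_in_wspan, simp)
qed

lemma wvec_up_wspan: "act (wvec i) (qsol 2) \<in> wspan (i + 1)"
proof (cases "i \<ge> 1")
  case False
  then show ?thesis by (simp only: wvec_up') (intro span_scale wvec_in_wspan, simp)
next
  case True
  then show ?thesis by (simp only: wvec_up) (intro wvec_in_wspan, simp)
qed

lemma wspan_C:
  assumes "v \<in> wspan r"
  shows "act v cons_C \<in> wspan (r + 1)"
  using assms
proof (induction rule: span_induct_alt)
  case base
  show ?case by (simp add: act_0_left span_zero)
next
  case (step c x y)
  then obtain i where i: "x = wvec i" "i \<le> r" by blast
  have "act x cons_C \<in> wspan (r + 1)"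
    unfolding i(1) wvec_C using i(2)
    by (intro span_add span_scale wspan_mono [OF _ wvec_up_wspan] wspan_mono [OF _ wvec_down_wspan]) auto
  then show ?case
    using step by (simp add: act_add_left act_scale_left span_add span_scale)
qed

text \<open>Induction along the linear recursion: \<open>C\<close> raises the top index by one and
  multiplies the leading coefficient by a power of \<open>t\<close>.\<close>

lemma bra_leading:
  "\<exists>d z. d \<noteq> 0 \<and> z \<in> wspan (int m) \<and> act (bra 0) (qsol (Suc m)) = scale d (wvec (int m + 1)) + z"
proof (induction m rule: induct_nat_012)
  case 0
  have "act (bra 0) (qsol (Suc 0)) = scale (tpow (- 1)) (wvec (int 0 + 1)) + 0"
    using wvec_weight [of 1] by (simp add: wvec_1)
  then show ?case using tpow_nonzero span_zero by blast
next
  case 1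
  have "act (bra 0) (qsol (Suc (Suc 0))) = scale 1 (wvec (int (Suc 0) + 1)) + 0"
    using wvec_up [of 1] by (simp add: wvec_1 numeral_2_eq_2)
  then show ?case using zero_neq_one span_zero by metis
next
  case (ge2 m)
  obtain d z d' z' where d: "d \<noteq> 0"
    and z: "z \<in> wspan (int (Suc m))" and z': "z' \<in> wspan (int m)"
    and eq: "act (bra 0) (qsol (Suc (Suc m))) = scale d (wvec (int (Suc m) + 1)) + z"
    and eq': "act (bra 0) (qsol (Suc m)) = scale d' (wvec (int m + 1)) + z'"
    using ge2 by blast
  let ?i = "int m + 2"
  \<comment> \<open>Everything below the leading term: the part of \<open>wvec ?i\<close> that
    \<open>C\<close> lowers, the image of the remainder \<open>z\<close>, and both parts of the
    vector for \<open>Q_m\<close>.\<close>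
  let ?u = "scale (tpow (-1) * d * tpow ?i) (act (wvec ?i) (qsol 0)) + scale (tpow (-1)) (act z cons_C)
     - scale (tpow (-1) * d') (wvec (int m + 1)) - scale (tpow (-1)) z'"
  have "act (bra 0) (qsol (Suc (Suc (Suc m)))) =
      scale (tpow (-1)) (act (act (bra 0) (qsol (Suc (Suc m)))) cons_C - act (bra 0) (qsol (Suc m)))"
    unfolding qsol.simps(3) [of "Suc m"]
    by (subst act_tor_mult) (simp_all add: diff_A A_plus.mult act_diff act_mult)
  also have "act (act (bra 0) (qsol (Suc (Suc m)))) cons_C =
      scale d (scale (tpow (?i + 1)) (wvec (?i + 1)) + scale (tpow ?i) (act (wvec ?i) (qsol 0))) + act z cons_C"
    unfolding eq using wvec_C [of ?i] wvec_up [of ?i]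
    by (simp add: act_add_left act_scale_left algebra_simps)
  finally have *: "act (bra 0) (qsol (Suc (Suc (Suc m)))) =
      scale (tpow (-1) * d * tpow (?i + 1)) (wvec (?i + 1)) + ?u"
    unfolding eq' by (simp add: scale_right_distrib scale_right_diff_distrib mult.assoc algebra_simps)
  have u: "?u \<in> wspan ?i"
    by (intro span_add span_diff span_scale wvec_in_wspan wspan_mono [OF _ z'] wspan_mono [OF _ wvec_down_wspan]
        wspan_mono [OF _ wspan_C [OF z]]) auto
  have i: "int (Suc (Suc m)) = ?i" by simp
  have "tpow (-1) * d * tpow (?i + 1) \<noteq> 0"
    using d tpow_nonzero by simp
  then show ?case
    unfolding i using u * by blast
qed

lemma bra_eq: "bra m = scale (tpow (int m + 1)) (act (bra 0) (qsol (Suc m)))"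
proof (cases "m = 0")
  case True
  have "act (bra 0) (qsol (Suc 0)) = scale (tpow (-1)) (bra 0)"
    using wvec_weight [of 1] by (simp add: wvec_1)
  then show ?thesis
    using True by (simp flip: tpow_add)
next
  case False
  then show ?thesis
    using bra_pos [of m] quantum_Q_system_unique [OF Q_system, of m] by simp
qed

text \<open>Acting with \<open>Q_0 - t^{-i}\<close> kills the term at \<open>i\<close> and
  multiplies \<open>v\<close> by \<open>t^{-j} - t^{-i}\<close>, which is nonzero because
  \<open>j\<close> differs from \<open>i\<close>. This leaves a shorter sum.\<close>

lemma weight_sum_eq_0:
  assumes "finite I" "j \<notin> I" "v = (\<Sum>i\<in>I. scale (c i) (wvec i))"
    and "act v (qsol (Suc 0)) = scale (tpow (- j)) v"
  shows "v = 0"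
  using assms
proof (induction I arbitrary: v c rule: finite_induct)
  case (insert i I)
  let ?v = "scale (tpow (- j) - tpow (- i)) v"
  have *: "act (\<Sum>i\<in>I. scale (c i) (wvec i)) (qsol (Suc 0)) = (\<Sum>i\<in>I. scale (c i) (act (wvec i) (qsol (Suc 0))))"
    for I c
    by (induction I rule: infinite_finite_induct) (simp_all add: act_0_left act_add_left act_scale_left)
  have "?v = act v (qsol (Suc 0)) - scale (tpow (- i)) v"
    using insert.prems by (simp add: scale_left_diff_distrib)
  also have "\<dots> = (\<Sum>k\<in>insert i I. scale ((tpow (- k) - tpow (- i)) * c k) (wvec k))"
    unfolding insert.prems(2) * wvec_weight scale_sum_right sum_subtractf [symmetric]
    by (intro sum.cong) (simp_all add: scale_left_diff_distrib left_diff_distrib right_diff_distrib mult.commute)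
  also have "\<dots> = (\<Sum>k\<in>I. scale ((tpow (- k) - tpow (- i)) * c k) (wvec k))"
    using insert.hyps by simp
  finally have *: "?v = (\<Sum>k\<in>I. scale ((tpow (- k) - tpow (- i)) * c k) (wvec k))" .
  have "?v = 0"
    by (rule insert.IH [OF _ *]) (use insert.prems in \<open>simp_all add: act_scale_left mult.commute\<close>)
  moreover have "tpow (- j) \<noteq> tpow (- i)"
    using insert.prems by (auto simp: tpow_eq_iff)
  ultimately show ?case
    using scale_eq_0 [of "tpow (- j) - tpow (- i)" v] by simp
qed simp

text \<open>Otherwise let \<open>M\<close> be the largest index in the expansion of this vector. Its
  term \<open>bra M\<close> contributes a nonzero multiple of \<open>wvec (M + 1)\<close>; solving
  for that multiple makes it a combination of \<open>wvec i\<close> with \<open>i <= M\<close>,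
  which the weights exclude.\<close>

lemma bra_0_annihilated: "act (bra 0) (qsol 0) = 0"
proof (rule ccontr)
  let ?v = "act (bra 0) (qsol 0)"
  assume "?v \<noteq> 0"
  have "?v \<in> wspan 0"
    using wvec_down_wspan [of 1] by (simp add: wvec_1)
  obtain M0 where M0: "\<forall>m>M0. ket m ?v = 0"
    using ket_finite by blast
  define M where "M = Max {m. ket m ?v \<noteq> 0}"
  have "m \<le> M0" if "ket m ?v \<noteq> 0" for m
    using M0 that by (metis not_le)
  then have "{m. ket m ?v \<noteq> 0} \<subseteq> {..M0}" by blast
  then have fin: "finite {m. ket m ?v \<noteq> 0}"
    by (rule finite_subset) simp
  moreover have "{m. ket m ?v \<noteq> 0} \<noteq> {}"
    using ket_separates \<open>?v \<noteq> 0\<close> by auto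
  ultimately have M: "ket M ?v \<noteq> 0"
    unfolding M_def using Max_in by blast
  have "ket m ?v = 0" if "m > M" for m
    using Max_ge [OF fin, of m] that unfolding M_def [symmetric] by auto
  then have v: "?v = (\<Sum>m\<le>M. scale (ket m ?v) (bra m))"
    by (rule ket_expand)
  obtain d z where d: "d \<noteq> 0" and z: "z \<in> wspan (int M)"
    and eq: "act (bra 0) (qsol (Suc M)) = scale d (wvec (int M + 1)) + z"
    using bra_leading by blast
  have low: "bra m \<in> wspan (int M)" if "m < M" for m
  proof -
    obtain d' z' where z': "z' \<in> wspan (int m)" and eq': "act (bra 0) (qsol (Suc m)) = scale d' (wvec (int m + 1)) + z'"
      using bra_leading by blast
    show ?thesis
      unfolding bra_eq [of m] eq' using that
      by (intro span_scale span_add wvec_in_wspan wspan_mono [OF _ z']) auto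
  qed
  let ?c = "ket M ?v * tpow (int M + 1) * d"
  let ?y = "scale ?c (wvec (int M + 1))"
  have "{..M} = insert M {..<M}" by auto
  then have "?v = scale (ket M ?v) (bra M) + (\<Sum>m<M. scale (ket m ?v) (bra m))"
    by (subst v) simp
  also have "scale (ket M ?v) (bra M) = ?y + scale (ket M ?v * tpow (int M + 1)) z"
    by (subst bra_eq [of M]) (simp add: eq scale_right_distrib mult.assoc)
  finally have "?y = ?v - (\<Sum>m<M. scale (ket m ?v) (bra m)) - scale (ket M ?v * tpow (int M + 1)) z"
    by (simp add: algebra_simps)
  also have "\<dots> \<in> wspan (int M)"
    using low by (intro span_diff span_sum span_scale z wspan_mono [OF _ \<open>?v \<in> wspan 0\<close>]) auto
  finally have "?y \<in> wspan (int M)" .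
  then obtain t r where t: "finite t" "t \<subseteq> wvec ` {..int M}" "?y = (\<Sum>a\<in>t. scale (r a) a)"
    unfolding span_explicit by blast
  \<comment> \<open>Distinctness of the vectors \<open>wvec i\<close> is not known, so one index is
    chosen for each vector in \<open>t\<close>.\<close>
  then obtain I where I: "I \<subseteq> {..int M}" "inj_on wvec I" "t = wvec ` I"
    unfolding subset_image_inj by blast
  have y: "?y = (\<Sum>i\<in>I. scale (r (wvec i)) (wvec i))"
    unfolding t(3) I(3) using I(2) by (simp add: sum.reindex)
  have "finite I"
    using t(1) I by (simp add: finite_image_iff)
  moreover have "int M + 1 \<notin> I" using I by auto
  moreover note y
  moreover have "act ?y (qsol (Suc 0)) = scale (tpow (- (int M + 1))) ?y"
    by (simp add: act_scale_left wvec_weight mult.commute)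
  ultimately have "?y = 0"
    by (rule weight_sum_eq_0)
  then show False
    using scale_eq_0 [of ?c "wvec (int M + 1)"] M d tpow_nonzero wvec_nonzero [of "int M + 1"] by simp
qed

text \<open>The normalisation \<open>t^{m+1}\<close> turns
  \<open>Q_m C = t Q_{m+1} + Q_{m-1}\<close> into this form; at \<open>m = 0\<close> the term with
  \<open>Q_{-1}\<close> is removed by \<open>bra_0_annihilated\<close>.\<close>

lemma bra_C: "act (bra m) cons_C = bra (Suc m) + (if m = 0 then 0 else scale (tpow 1) (bra (m - 1)))"
proof -
  have eq: "qsol (Suc m) * cons_C = tor 1 0 0 * qsol (Suc (Suc m)) + qsol m"
    by (rule qsol_C)
  have "act (bra m) cons_C = scale (tpow (int m + 1)) (act (bra 0) (qsol (Suc m) * cons_C))"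
    by (subst bra_eq) (simp add: act_scale_left act_mult)
  also have "\<dots> = scale (tpow (int m + 1)) (scale (tpow 1) (act (bra 0) (qsol (Suc (Suc m)))) + act (bra 0) (qsol m))"
    unfolding eq by (simp add: act_add_right act_tor_mult A_plus.mult)
  also have "\<dots> = bra (Suc m) + scale (tpow (int m + 1)) (act (bra 0) (qsol m))"
    by (subst bra_eq [of "Suc m"]) (simp add: scale_right_distrib algebra_simps flip: tpow_add)
  also have "scale (tpow (int m + 1)) (act (bra 0) (qsol m)) = (if m = 0 then 0 else scale (tpow 1) (bra (m - 1)))"
  proof (cases m)
    case (Suc k)
    then show ?thesis
      using bra_eq [of k] by (simp add: algebra_simps flip: tpow_add)
  qed (simp add: bra_0_annihilated)
  finally show ?thesis .
qed

text \<open>The transpose of \<open>bra_C\<close>, read off on the basis and extended by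
  linearity.\<close>

lemma ket_C: "ket l (act v cons_C) = (if l = 0 then 0 else ket (l - 1) v) + tpow 1 * ket (Suc l) v"
proof -
  have "v \<in> span (range bra)" by (simp add: span_bra)
  then show ?thesis
  proof (induction rule: span_induct_alt)
    case base
    show ?case by (simp add: act_0_left ket_0)
  next
    case (step c x y)
    then obtain m where x: "x = bra m" by blast
    have "ket l (act x cons_C) = (if l = 0 then 0 else ket (l - 1) x) + tpow 1 * ket (Suc l) x"
      unfolding x bra_C by (cases m; cases l) (simp_all add: ket_add ket_scale ket_bra ket_0)
    with step.IH show ?case
      by (simp add: act_add_left act_scale_left ket_add ket_scale algebra_simps)
  qed
qed

end


section \<open>Comparison of the recursions\<close>

lemma puiseux_of_add: "puiseux_of (x + y) = puiseux_of x + puiseux_of y"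
  by (simp add: puiseux_of_def frag_extend_add)

lemma puiseux_of_diff: "puiseux_of (x - y) = puiseux_of x - puiseux_of y"
  by (simp add: puiseux_of_def frag_extend_diff)

lemma puiseux_of_0 [simp]: "puiseux_of 0 = 0"
  by (simp add: puiseux_of_def)

definition rpow :: "rat \<Rightarrow> puiseux" where
  "rpow r = Poly_Mapping.single r 1"

lemma rpow_add: "rpow (r + s) = rpow r * rpow s"
  by (simp add: rpow_def mult_single)

lemma puiseux_of_tpow: "puiseux_of (tpow k) = rpow (of_int k)"
  by (simp add: puiseux_of_def tpow_def rpow_def)

lemma puiseux_of_tpow_mult: "puiseux_of (tpow k * x) = rpow (of_int k) * puiseux_of x"
  using subset_UNIV [of "Poly_Mapping.keys x"]
proof (induction x rule: frag_induction)
  case (one x)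
  then show ?case
    by (simp add: tpow_def rpow_def puiseux_of_def mult_single)
qed (simp_all add: puiseux_of_diff right_diff_distrib)

lemma lookup_puiseux_of: "Poly_Mapping.lookup (puiseux_of x) (of_int k) = Poly_Mapping.lookup x k"
  using subset_UNIV [of "Poly_Mapping.keys x"]
proof (induction x rule: frag_induction)
  case (one x)
  then show ?case by (simp add: puiseux_of_def lookup_single when_def)
qed (simp_all add: puiseux_of_diff lookup_minus)

text \<open>Lets truncated sums for different \<open>K\<close> be compared after embedding.\<close>

lemma inj_puiseux_of: "inj puiseux_of"
  by (rule injI, rule poly_mapping_eqI) (metis lookup_puiseux_of)

section \<open>Unit steps of \<open>n\<close> and the exponent of the prefactor\<close>

definition inc :: "nat \<Rightarrow> (nat \<Rightarrow> nat) \<Rightarrow> nat \<Rightarrow> nat" where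
  "inc k n = n(k := Suc (n k))"

lemma inc_same [simp]: "inc k n k = Suc (n k)"
  by (simp add: inc_def)

lemma inc_other [simp]: "i \<noteq> k \<Longrightarrow> inc k n i = n i"
  by (simp add: inc_def)

lemma min_sum_inc: "k \<le> K \<Longrightarrow> min_sum K (inc k n) i = min_sum K n i + int (min i k)"
  by (cases "k = 0") (simp_all add: min_sum_upd inc_def, simp add: min_sum_def)

lemma min_sum_stable:
  assumes "\<forall>i>k. n i = 0" "k \<le> i"
  shows "min_sum K n i = min_sum K n k"
  unfolding min_sum_def using assms by (intro sum.cong) (auto simp: min_def not_le)

text \<open>\<open>A n\<close> is flat from \<open>Suc j\<close> on, so its kink at
  \<open>Suc j\<close> is the slope just before.\<close>

lemma min_sum_pred:
  assumes "\<forall>i>Suc j. n i = 0" "Suc j < K"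
  shows "min_sum K n j = min_sum K n (Suc j) - int (n (Suc j))"
  using min_sum_second_diff [of "Suc j" K n] min_sum_stable [OF assms(1), of "Suc (Suc j)" K] assms(2) by simp

definition min_form :: "nat \<Rightarrow> (nat \<Rightarrow> nat) \<Rightarrow> int" where
  "min_form K n = (\<Sum>i=1..K. int (n i) * min_sum K n i)"

lemma min_form_inc:
  assumes "k \<le> K"
  shows "min_form K (inc k n) = min_form K n + 2 * min_sum K n k + int k"
proof (cases "k = 0")
  case True
  then show ?thesis
    by (simp add: min_form_def min_sum_inc)
next
  case False
  then have "k \<in> {1..K}" using assms by simp
  from weight_upd [OF this, of n "\<lambda>i. 0"] show ?thesis
    unfolding min_form_def inc_def
    by (simp add: distrib_left sum.distrib sum_distrib_left min_sum_def min.commute mult_ac)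
qed

text \<open>The exponent of the prefactor as a power of \<open>t\<close>. The first sum includes
  \<open>n 0\<close>, the power of \<open>Q_0\<close> in the word: the recursion at the lowest
  position produces \<open>e_0\<close>, and this term compensates the factor \<open>t^{-1}\<close>
  by which \<open>Q_0\<close> acts on \<open>bra 0\<close>.\<close>

definition tdeg :: "nat \<Rightarrow> (nat \<Rightarrow> nat) \<Rightarrow> nat \<Rightarrow> rat" where
  "tdeg K n l = of_nat (\<Sum>i\<le>K. n i) + (of_nat l + of_int (min_form K n)) / 2"

lemma tdeg_inc:
  assumes "k \<le> K"
  shows "tdeg K (inc k n) l = tdeg K n l + 1 + of_int (min_sum K n k) + of_nat k / 2"
proof -
  have "(\<Sum>i\<le>K. inc k n i) = (\<Sum>i\<le>K. n i + (if i = k then 1 else 0))"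
    by (intro sum.cong) (auto simp: inc_def)
  then have "(\<Sum>i\<le>K. inc k n i) = (\<Sum>i\<le>K. n i) + 1"
    using assms by (simp add: sum.distrib)
  then show ?thesis
    unfolding tdeg_def min_form_inc [OF assms] by (simp add: field_simps)
qed

lemma tdeg_Suc: "tdeg K n (Suc l) = tdeg K n l + 1 / 2"
  by (simp add: tdeg_def field_simps)

section \<open>Ordered words in the \<open>Q_i\<close> and their reordering\<close>

definition qword :: "nat \<Rightarrow> (nat \<Rightarrow> nat) \<Rightarrow> qtorus" where
  "qword K n = prod_list (map (\<lambda>i. qsol (Suc i) ^ n i) [0..<Suc K])"

lemma qword_0: "qword 0 n = qsol (Suc 0) ^ n 0"
  by (simp add: qword_def)

lemma qword_Suc: "qword (Suc K) n = qword K n * qsol (Suc (Suc K)) ^ n (Suc K)"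
  by (simp add: qword_def mult.assoc)

lemma qword_cong: "(\<And>i. i \<le> K \<Longrightarrow> n i = n' i) \<Longrightarrow> qword K n = qword K n'"
  unfolding qword_def by (intro arg_cong [where f = prod_list] map_cong) auto

lemma qword_stable:
  assumes "k \<le> K" "\<forall>i>k. n i = 0"
  shows "qword K n = qword k n"
  using assms(1) by (induction K rule: dec_induct) (simp_all add: qword_Suc assms(2))

lemma qsol_power_left:
  "qsol (Suc a) ^ c * qsol a = tor (- int c) 0 0 * (qsol a * qsol (Suc a) ^ c)"
proof (induction c)
  case (Suc c)
  have "qsol (Suc a) * qsol a = tor (-1) 0 0 * (qsol a * qsol (Suc a))"
    unfolding qsol_commute tor_scalar_collect by (simp add: tor_one)
  then have "qsol (Suc a) ^ Suc c * qsol a = qsol (Suc a) ^ c * (tor (-1) 0 0 * (qsol a * qsol (Suc a)))"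
    by (simp add: power_Suc2 mult.assoc del: power_Suc)
  also have "\<dots> = tor (-1) 0 0 * ((qsol (Suc a) ^ c * qsol a) * qsol (Suc a))"
    by (simp add: tor_scalar_left_commute mult.assoc)
  also have "\<dots> = tor (- int (Suc c)) 0 0 * (qsol a * qsol (Suc a) ^ Suc c)"
    unfolding Suc by (simp add: mult.assoc tor_scalar_collect power_Suc2 del: power_Suc)
  finally show ?case .
qed (simp add: tor_one)

lemma qsol_power_right:
  "qsol (Suc a) * qsol a ^ c = tor (- int c) 0 0 * (qsol a ^ c * qsol (Suc a))"
proof (induction c)
  case (Suc c)
  have "qsol (Suc a) * qsol a = tor (-1) 0 0 * (qsol a * qsol (Suc a))"
    unfolding qsol_commute tor_scalar_collect by (simp add: tor_one)
  then have "qsol (Suc a) * qsol a ^ Suc c = tor (-1) 0 0 * (qsol a * qsol (Suc a)) * qsol a ^ c"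
    by (metis mult.assoc power_Suc)
  also have "\<dots> = tor (-1) 0 0 * (qsol a * (qsol (Suc a) * qsol a ^ c))"
    by (simp only: mult.assoc)
  also have "qsol a * (qsol (Suc a) * qsol a ^ c) = tor (- int c) 0 0 * (qsol a ^ Suc c * qsol (Suc a))"
    unfolding Suc by (simp add: tor_scalar_left_commute mult.assoc)
  finally show ?case
    by (simp add: tor_scalar_collect del: power_Suc)
qed (simp add: tor_one)

lemma qword_inc_top:
  assumes "k \<le> K" "\<forall>i>k. n i = 0"
  shows "qword K (inc k n) = qword K n * qsol (Suc k)"
proof -
  have "qword K (inc k n) = qword k (inc k n)"
    using assms by (intro qword_stable) auto
  moreover have "qword k (inc k n) = qword k n * qsol (Suc k)"
  proof (cases k)
    case 0
    then show ?thesis by (simp add: qword_0 power_Suc2 del: power_Suc)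
  next
    case (Suc j)
    have "qword j (inc k n) = qword j n"
      using Suc by (intro qword_cong) auto
    then show ?thesis
      by (simp add: Suc qword_Suc power_Suc2 mult.assoc del: power_Suc)
  qed
  ultimately show ?thesis
    using qword_stable [OF assms] by simp
qed

text \<open>\<open>Q_j\<close> moves left past the \<open>n (Suc j)\<close> final copies of
  \<open>Q_{j+1}\<close>, each giving a factor \<open>t^{-1}\<close>.\<close>

lemma qword_inc_below:
  assumes "Suc j \<le> K" "\<forall>i>Suc j. n i = 0"
  shows "qword K n * qsol (Suc j) = tor (- int (n (Suc j))) 0 0 * qword K (inc j n)"
proof -
  have 1: "qword K n = qword j n * qsol (Suc (Suc j)) ^ n (Suc j)"
    using qword_stable [OF assms] by (simp add: qword_Suc)
  have "qword K (inc j n) = qword (Suc j) (inc j n)"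
    using assms by (intro qword_stable) auto
  also have "\<dots> = qword j (inc j n) * qsol (Suc (Suc j)) ^ n (Suc j)"
    by (simp add: qword_Suc)
  also have "qword j (inc j n) = qword j n * qsol (Suc j)"
  proof -
    \<comment> \<open>Only exponents up to \<open>j\<close> enter, so \<open>n\<close> may be cut
      off there to satisfy the support condition of \<open>qword_inc_top\<close>.\<close>
    have "qword j (inc j n) = qword j (inc j (\<lambda>i. if i \<le> j then n i else 0))"
      by (intro qword_cong) (auto simp: inc_def)
    also have "\<dots> = qword j (\<lambda>i. if i \<le> j then n i else 0) * qsol (Suc j)"
      by (intro qword_inc_top) auto
    also have "qword j (\<lambda>i. if i \<le> j then n i else 0) = qword j n"
      by (intro qword_cong) auto
    finally show ?thesis .
  qed
  finally show ?thesis
    unfolding 1 by (simp add: mult.assoc qsol_power_left tor_scalar_left_commute)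
qed

text \<open>Two copies of \<open>Q_{j+1}\<close> are brought in front of the others and rewritten by
  \<open>qsol_quadratic'\<close>. The new \<open>Q_j\<close> is already in its place, while
  \<open>Q_{j+2}\<close> moves to the end past \<open>n (Suc j)\<close> copies of
  \<open>Q_{j+1}\<close>.\<close>

lemma qword_square:
  assumes "Suc (Suc j) \<le> K" "\<forall>i>Suc j. n i = 0"
  shows "qword K (inc (Suc j) (inc (Suc j) n)) =
    tor (-1 - int (n (Suc j))) 0 0 * qword K (inc (Suc (Suc j)) (inc j n)) + tor (-2) 0 0 * qword K n"
proof -
  let ?c = "n (Suc j)" and ?P = "qword j n"
  have n: "qword K n = ?P * qsol (Suc (Suc j)) ^ ?c"
    using qword_stable [of "Suc j" K n] assms by (simp add: qword_Suc)
  have sq: "qsol (Suc (Suc j)) * qsol (Suc (Suc j)) =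
      tor (-1) 0 0 * (qsol (Suc j) * qsol (Suc (Suc (Suc j)))) + tor (-2) 0 0"
  proof -
    have "qsol (Suc (Suc j)) * qsol (Suc (Suc j)) = tor (-1) 0 0 * (tor 1 0 0 * (qsol (Suc (Suc j)) * qsol (Suc (Suc j))))"
      by (simp only: tor_scalar_collect) (simp add: tor_one)
    then show ?thesis
      unfolding qsol_quadratic' by (simp add: distrib_left tor_mult)
  qed
  have "qword K (inc (Suc j) (inc (Suc j) n)) = qword K n * qsol (Suc (Suc j)) * qsol (Suc (Suc j))"
    using assms by (simp add: qword_inc_top)
  also have "\<dots> = ?P * (qsol (Suc (Suc j)) * qsol (Suc (Suc j))) * qsol (Suc (Suc j)) ^ ?c"
  proof -
    have "qsol (Suc (Suc j)) ^ ?c * (qsol (Suc (Suc j)) * qsol (Suc (Suc j))) =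
        (qsol (Suc (Suc j)) * qsol (Suc (Suc j))) * qsol (Suc (Suc j)) ^ ?c"
      by (rule power_commuting_commutes) (simp add: mult.assoc)
    then show ?thesis
      unfolding n by (simp add: mult.assoc)
  qed
  also have "\<dots> = tor (-1) 0 0 * (?P * qsol (Suc j) * (qsol (Suc (Suc (Suc j))) * qsol (Suc (Suc j)) ^ ?c))
      + tor (-2) 0 0 * qword K n"
    unfolding sq n by (simp add: distrib_left distrib_right mult.assoc tor_scalar_left_commute tor_scalar_commute [of ?P])
  also have "?P * qsol (Suc j) * (qsol (Suc (Suc (Suc j))) * qsol (Suc (Suc j)) ^ ?c) =
      tor (- int ?c) 0 0 * (?P * (qsol (Suc j) * qsol (Suc (Suc j)) ^ ?c) * qsol (Suc (Suc (Suc j))))"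
    unfolding qsol_power_right by (simp add: mult.assoc tor_scalar_left_commute)
  also have "?P * (qsol (Suc j) * qsol (Suc (Suc j)) ^ ?c) = qword K (inc j n)"
  proof -
    have "qword K (inc j n) = tor (int ?c) 0 0 * (qword K n * qsol (Suc j))"
      using qword_inc_below [of j K n] assms by (simp add: tor_scalar_collect tor_one)
    also have "qword K n * qsol (Suc j) = tor (- int ?c) 0 0 * (?P * (qsol (Suc j) * qsol (Suc (Suc j)) ^ ?c))"
      unfolding n by (simp add: mult.assoc qsol_power_left tor_scalar_left_commute)
    also have "tor (int ?c) 0 0 * \<dots> = ?P * (qsol (Suc j) * qsol (Suc (Suc j)) ^ ?c)"
      by (simp add: tor_scalar_collect tor_one)
    finally show ?thesis by simp
  qed
  also have "qword K (inc j n) * qsol (Suc (Suc (Suc j))) = qword K (inc (Suc (Suc j)) (inc j n))"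
    using assms by (simp add: qword_inc_top)
  finally show ?thesis
    by (simp add: tor_scalar_collect)
qed

section \<open>Recursions for the matrix elements and the induction on \<open>n\<close>\<close>

context Q_rep
begin

lemma qword_A: "qword K n \<in> A"
  by (induction K) (simp_all add: qword_0 qword_Suc A_plus.mult power_A)

definition phi :: "nat \<Rightarrow> qtorus \<Rightarrow> laurent" where
  "phi l x = ket l (act (bra 0) x)"

lemma phi_add: "x \<in> A \<Longrightarrow> y \<in> A \<Longrightarrow> phi l (x + y) = phi l x + phi l y"
  by (simp add: phi_def act_add_right ket_add)

lemma phi_tor_mult: "x \<in> A \<Longrightarrow> phi l (tor c 0 0 * x) = tpow c * phi l x"
  by (simp add: phi_def act_tor_mult ket_scale)

lemma phi_C: "x \<in> A \<Longrightarrow> phi l (x * cons_C) = (if l = 0 then 0 else phi (l - 1) x) + tpow 1 * phi (Suc l) x"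
  by (simp add: phi_def act_mult ket_C)

lemma act_Q0_power: "act (bra 0) (qsol (Suc 0) ^ n) = scale (tpow (- int n)) (bra 0)"
proof (induction n)
  case (Suc n)
  have "act (bra 0) (qsol (Suc 0) ^ Suc n) = act (act (bra 0) (qsol (Suc 0) ^ n)) (qsol (Suc 0))"
    by (simp only: power_Suc2 act_mult power_A qsol_A)
  also have "\<dots> = scale (tpow (- int n)) (scale (tpow (- 1)) (bra 0))"
    using wvec_weight [of 1] by (simp add: Suc wvec_1 act_scale_left)
  also have "\<dots> = scale (tpow (- int (Suc n))) (bra 0)"
    unfolding scale_scale tpow_add [symmetric] by (intro arg_cong2 [where f = scale] arg_cong [where f = tpow]) simp_all
  finally show ?case .
qed (simp add: act_1)

text \<open>The word for \<open>n + e_{j+1}\<close> ends in \<open>Q_{j+1}\<close>. Multiplied by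
  \<open>C\<close> it yields \<open>t Q_{j+2} + Q_j\<close>, while \<open>phi_C\<close> transfers
  \<open>C\<close> to the dual vector.\<close>

lemma phi_exchange:
  assumes "Suc (Suc j) \<le> K" "\<forall>i>Suc j. n i = 0"
  shows "tpow 1 * phi l (qword K (inc (Suc (Suc j)) n)) + tpow (- int (n (Suc j))) * phi l (qword K (inc j n)) =
    (if l = 0 then 0 else phi (l - 1) (qword K (inc (Suc j) n))) + tpow 1 * phi (Suc l) (qword K (inc (Suc j) n))"
proof -
  have "qword K (inc (Suc j) n) * cons_C = qword K n * (qsol (Suc (Suc j)) * cons_C)"
    using assms by (simp add: qword_inc_top mult.assoc)
  also have "\<dots> = tor 1 0 0 * (qword K n * qsol (Suc (Suc (Suc j)))) + qword K n * qsol (Suc j)"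
    unfolding qsol_C by (simp add: distrib_left tor_scalar_left_commute)
  also have "qword K n * qsol (Suc (Suc (Suc j))) = qword K (inc (Suc (Suc j)) n)"
    using assms by (simp add: qword_inc_top)
  also have "qword K n * qsol (Suc j) = tor (- int (n (Suc j))) 0 0 * qword K (inc j n)"
    using assms by (intro qword_inc_below) auto
  finally show ?thesis
    using phi_C [of "qword K (inc (Suc j) n)" l]
    by (simp add: phi_add phi_tor_mult qword_A A_plus.mult)
qed

definition fermionic_eq :: "nat \<Rightarrow> (nat \<Rightarrow> nat) \<Rightarrow> bool" where
  "fermionic_eq K n \<longleftrightarrow>
     (\<forall>l. puiseux_of (fsum K (min_sum K n) (int l)) = rpow (tdeg K n l) * puiseux_of (phi l (qword K n)))"

lemma fermionic_eq_base0:
  assumes "K \<ge> 1" "\<forall>i>0. n i = 0"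
  shows "fermionic_eq K n"
  unfolding fermionic_eq_def
proof
  fix l
  have 0: "min_sum K n i = 0" for i
    using assms(2) by (simp add: min_sum_def)
  have "phi l (qword K n) = (if l = 0 then tpow (- int (n 0)) else 0)"
    using qword_stable [of 0 K n] assms by (simp add: qword_0 phi_def act_Q0_power ket_scale ket_bra)
  moreover have "fsum K (min_sum K n) (int l) = (if l = 0 then 1 else 0)"
    using assms by (simp add: fsum_small 0)
  moreover have "tdeg K n 0 = of_nat (n 0)"
  proof -
    have "(\<Sum>i\<le>K. n i) = (\<Sum>i\<le>K. if i = 0 then n 0 else 0)"
      using assms(2) by (intro sum.cong) auto
    then show ?thesis by (simp add: tdeg_def min_form_def 0)
  qed
  ultimately show "puiseux_of (fsum K (min_sum K n) (int l)) = rpow (tdeg K n l) * puiseux_of (phi l (qword K n))"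
    using puiseux_of_tpow [of 0] by (simp add: puiseux_of_tpow flip: rpow_add)
qed

text \<open>The word is \<open>Q_0^{n_0} Q_1\<close>, and \<open>Q_1\<close> takes
  \<open>bra 0\<close> to \<open>t^{-2}\<close> times \<open>bra 1\<close>.\<close>

lemma fermionic_eq_base1:
  assumes "K \<ge> 1" "\<forall>i>0. n i = 0"
  shows "fermionic_eq K (inc 1 n)"
  unfolding fermionic_eq_def
proof
  fix l
  have 0: "min_sum K n i = 0" for i
    using assms(2) by (simp add: min_sum_def)
  have 1: "min_sum K (inc 1 n) i = int (min i 1)" for i
    using min_sum_inc [of 1 K n i] assms by (simp add: 0)
  have "qword K (inc 1 n) = qsol (Suc 0) ^ n 0 * qsol (Suc (Suc 0))"
    using qword_inc_top [of 1 K n] qword_stable [of 0 K n] assms by (simp add: qword_0)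
  then have "phi l (qword K (inc 1 n)) = tpow (- int (n 0)) * ket l (act (bra 0) (qsol (Suc (Suc 0))))"
    by (simp add: phi_def act_mult power_A act_Q0_power act_scale_left ket_scale)
  also have "act (bra 0) (qsol (Suc (Suc 0))) = scale (tpow (-2)) (bra 1)"
    by (subst bra_eq [of 1]) (simp flip: tpow_add)
  also have "tpow (- int (n 0)) * ket l \<dots> = (if l = 1 then tpow (- int (n 0) - 2) else 0)"
    by (simp add: ket_scale ket_bra flip: tpow_add)
  finally have phi: "phi l (qword K (inc 1 n)) = (if l = 1 then tpow (- int (n 0) - 2) else 0)" .
  have "fsum K (min_sum K (inc 1 n)) (int l) = (if int l = min_sum K (inc 1 n) K then 1 else 0)"
    using assms(1) 1 [of 1] min_sum_nonneg by (intro fsum_small) auto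
  then have f: "fsum K (min_sum K (inc 1 n)) (int l) = (if l = 1 then 1 else 0)"
    using assms unfolding 1 by simp
  have "(\<Sum>i\<le>K. n i) = (\<Sum>i\<le>K. if i = 0 then n 0 else 0)"
    using assms(2) by (intro sum.cong) auto
  then have "tdeg K (inc 1 n) 1 = of_nat (n 0) + 2"
    using assms by (subst tdeg_inc) (simp_all add: tdeg_def min_form_def 0)
  then show "puiseux_of (fsum K (min_sum K (inc 1 n)) (int l)) =
      rpow (tdeg K (inc 1 n) l) * puiseux_of (phi l (qword K (inc 1 n)))"
    unfolding phi f using puiseux_of_tpow [of 0] by (simp add: puiseux_of_tpow flip: rpow_add)
qed

text \<open>With the common factor \<open>t^{g - 1/2}\<close> taken out, the prefactors at
  \<open>l - 1\<close>, \<open>l + 1\<close>, \<open>n + e_{j+2}\<close> and \<open>n + e_j\<close>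
  become \<open>1\<close>, \<open>t\<close>, \<open>t\<close> and \<open>t^{-n_{j+1}}\<close>. These
  are the coefficients of \<open>phi_exchange\<close>, so it matches \<open>fsum_exchange\<close>
  term by term.\<close>

lemma fermionic_eq_exchange:
  assumes j: "Suc (Suc j) \<le> K" and supp: "\<forall>i>Suc j. n i = 0"
    and large: "min_sum K n K + int (Suc j) \<le> 2 * int K"
    and ih: "fermionic_eq K (inc (Suc j) n)" "fermionic_eq K (inc j n)"
  shows "fermionic_eq K (inc (Suc (Suc j)) n)"
  unfolding fermionic_eq_def
proof
  fix l
  let ?a = "min_sum K (inc (Suc j) n)" and ?g = "tdeg K n l + 1 + of_int (min_sum K n (Suc j)) + of_nat (Suc j) / 2"
  let ?P = "\<lambda>l k. puiseux_of (phi l (qword K (inc k n)))"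
  have a: "?a i = min_sum K n i + int (min i (Suc j))" for i
    using j by (simp add: min_sum_inc)
  have stab: "min_sum K n i = min_sum K n (Suc j)" if "Suc j \<le> i" for i
    using that by (rule min_sum_stable [OF supp])
  have "fsum K (\<lambda>i. ?a i + of_bool (i \<ge> Suc j + 1)) (int l) + fsum K (\<lambda>i. ?a i - of_bool (i \<ge> Suc j)) (int l) =
      fsum K ?a (int l - 1) + fsum K ?a (int l + 1)"
  proof (rule fsum_exchange)
    show "?a i = ?a (Suc j)" if "Suc j \<le> i" for i
      unfolding a stab [OF that] using that by simp
    show "?a (Suc j - 1) \<le> ?a (Suc j)"
      using min_sum_pred [OF supp, of K] j by (simp add: a)
    show "?a (Suc j) \<le> 2 * int K"
      using large stab [of K] j by (simp add: a)
  qed (use j in simp_all)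
  moreover have "(\<lambda>i. ?a i + of_bool (i \<ge> Suc j + 1)) = min_sum K (inc (Suc (Suc j)) n)"
    using j by (auto simp: fun_eq_iff a min_sum_inc min_def of_bool_def)
  moreover have "(\<lambda>i. ?a i - of_bool (i \<ge> Suc j)) = min_sum K (inc j n)"
    using j by (auto simp: fun_eq_iff a min_sum_inc min_def of_bool_def)
  ultimately have *: "fsum K (min_sum K (inc (Suc (Suc j)) n)) (int l) =
      fsum K ?a (int l - 1) + fsum K ?a (int (Suc l)) - fsum K (min_sum K (inc j n)) (int l)"
    by (simp add: eq_diff_eq add.commute)
  have gk: "tdeg K (inc (Suc j) n) l = ?g"
    using j by (simp add: tdeg_inc)
  have t1: "puiseux_of (fsum K ?a (int l - 1)) = rpow (?g - 1 / 2) * (if l = 0 then 0 else ?P (l - 1) (Suc j))"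
  proof (cases l)
    case 0
    then show ?thesis using j by (simp add: fsum_neg)
  next
    case (Suc l')
    then have "tdeg K (inc (Suc j) n) l' = ?g - 1 / 2"
      using gk tdeg_Suc [of K "inc (Suc j) n" l'] by simp
    then show ?thesis
      using ih(1) Suc by (simp add: fermionic_eq_def)
  qed
  have t2: "puiseux_of (fsum K ?a (int (Suc l))) = rpow (?g - 1 / 2) * (rpow 1 * ?P (Suc l) (Suc j))"
  proof -
    have "tdeg K (inc (Suc j) n) (Suc l) = (?g - 1 / 2) + 1"
      using gk tdeg_Suc [of K "inc (Suc j) n" l] by simp
    then show ?thesis
      using ih(1) by (simp only: fermionic_eq_def rpow_add mult.assoc)
  qed
  have t3: "puiseux_of (fsum K (min_sum K (inc j n)) (int l)) = rpow (?g - 1 / 2) * (rpow (- of_nat (n (Suc j))) * ?P l j)"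
  proof -
    have "tdeg K (inc j n) l = (?g - 1 / 2) + (- of_nat (n (Suc j)))"
      using j min_sum_pred [OF supp, of K] by (simp add: tdeg_inc field_simps)
    then show ?thesis
      using ih(2) by (simp only: fermionic_eq_def rpow_add mult.assoc)
  qed
  have t4: "rpow (tdeg K (inc (Suc (Suc j)) n) l) = rpow (?g - 1 / 2) * rpow 1"
  proof -
    have "tdeg K (inc (Suc (Suc j)) n) l = (?g - 1 / 2) + 1"
      using j stab [of "Suc (Suc j)"] by (simp add: tdeg_inc field_simps)
    then show ?thesis by (simp only: rpow_add)
  qed
  have "puiseux_of (tpow 1 * phi l (qword K (inc (Suc (Suc j)) n)) + tpow (- int (n (Suc j))) * phi l (qword K (inc j n))) =
    puiseux_of ((if l = 0 then 0 else phi (l - 1) (qword K (inc (Suc j) n))) + tpow 1 * phi (Suc l) (qword K (inc (Suc j) n)))"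
    by (rule arg_cong [OF phi_exchange [OF j supp]])
  then have P: "rpow 1 * ?P l (Suc (Suc j)) =
      (if l = 0 then 0 else ?P (l - 1) (Suc j)) + rpow 1 * ?P (Suc l) (Suc j) - rpow (- of_nat (n (Suc j))) * ?P l j"
    by (simp add: puiseux_of_add puiseux_of_tpow_mult eq_diff_eq split: if_splits)
  show "puiseux_of (fsum K (min_sum K (inc (Suc (Suc j)) n)) (int l)) =
      rpow (tdeg K (inc (Suc (Suc j)) n) l) * ?P l (Suc (Suc j))"
    unfolding * puiseux_of_add puiseux_of_diff t1 t2 t3 t4 mult.assoc P by (simp only: distrib_left right_diff_distrib)
qed

text \<open>\<open>fsum_step\<close> is taken at \<open>a = A (n + 2 e_{j+1})\<close>. Since
  \<open>A (2 e_{j+1} - e_j - e_{j+2})\<close> is the unit vector at \<open>j + 1\<close>, lowering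
  that entry gives \<open>A (n + e_j + e_{j+2})\<close>; the other term belongs to \<open>n\<close>.
  The powers of \<open>t\<close> then agree with \<open>qword_square\<close>.\<close>

lemma fermionic_eq_square:
  assumes j: "Suc (Suc j) \<le> K" and supp: "\<forall>i>Suc j. n i = 0"
    and ih: "fermionic_eq K (inc (Suc (Suc j)) (inc j n))" "fermionic_eq K n"
  shows "fermionic_eq K (inc (Suc j) (inc (Suc j) n))"
  unfolding fermionic_eq_def
proof
  fix l
  let ?n = "inc (Suc j) (inc (Suc j) n)" and ?n' = "inc (Suc (Suc j)) (inc j n)"
  let ?a = "min_sum K ?n" and ?P = "\<lambda>n. puiseux_of (phi l (qword K n))"
  have a: "?a i = min_sum K n i + 2 * int (min i (Suc j))" for i
    using j by (simp only: min_sum_inc) simp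
  have sd: "min_sum K n j + min_sum K n (Suc (Suc j)) = 2 * min_sum K n (Suc j) - int (n (Suc j))"
    using min_sum_second_diff [of "Suc j" K n] j by simp
  have step: "fsum K ?a (int l) = fsum K (?a(Suc j := ?a (Suc j) - 1)) (if Suc j = K then int l - 1 else int l) +
      qpow (int (Suc j) - ?a (Suc j)) * fsum K (\<lambda>i. ?a i - 2 * int (min i (Suc j))) (int l)"
    using j sd by (intro fsum_step) (auto simp: a)
  have "(\<lambda>i. ?a i - 2 * int (min i (Suc j))) = min_sum K n"
    by (simp add: a)
  moreover have "(?a(Suc j := ?a (Suc j) - 1)) i = min_sum K ?n' i" for i
  proof -
    have "min_sum K ?n' i = min_sum K n i + int (min i j) + int (min i (Suc (Suc j)))"
      using j by (simp only: min_sum_inc)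
    then show ?thesis
      by (auto simp: a min_def)
  qed
  then have "?a(Suc j := ?a (Suc j) - 1) = min_sum K ?n'" by blast
  moreover have "qpow (int (Suc j) - ?a (Suc j)) = tpow (2 * min_sum K n (Suc j) + 2 * int (Suc j))"
    by (simp add: a qpow_def algebra_simps)
  ultimately have step': "puiseux_of (fsum K ?a (int l)) =
     puiseux_of (fsum K (min_sum K ?n') (int l)) +
     rpow (2 * of_int (min_sum K n (Suc j)) + 2 * of_nat (Suc j)) * puiseux_of (fsum K (min_sum K n) (int l))"
    using step j by (simp add: puiseux_of_add puiseux_of_tpow_mult)
  have g: "tdeg K ?n l = tdeg K n l + 2 + 2 * of_int (min_sum K n (Suc j)) + 2 * of_nat (Suc j)"
    using j by (simp only: tdeg_inc min_sum_inc) (simp add: field_simps)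
  have g': "tdeg K ?n' l = tdeg K ?n l - 1 - of_nat (n (Suc j))"
    unfolding g using j min_sum_pred [OF supp, of K] min_sum_stable [OF supp, of "Suc (Suc j)" K]
    by (simp only: tdeg_inc min_sum_inc) (simp add: field_simps)
  have "phi l (qword K ?n) = tpow (-1 - int (n (Suc j))) * phi l (qword K ?n') + tpow (-2) * phi l (qword K n)"
    unfolding qword_square [OF j supp] by (simp add: phi_add phi_tor_mult qword_A A_plus.mult)
  then have "?P ?n = rpow (-1 - of_nat (n (Suc j))) * ?P ?n' + rpow (-2) * ?P n"
    by (simp add: puiseux_of_add puiseux_of_tpow_mult)
  then have "rpow (tdeg K ?n l) * ?P ?n =
      rpow (tdeg K ?n l + (-1 - of_nat (n (Suc j)))) * ?P ?n' + rpow (tdeg K ?n l + (-2)) * ?P n"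
    by (simp only: rpow_add distrib_left mult.assoc)
  also have "tdeg K ?n l + (-1 - of_nat (n (Suc j))) = tdeg K ?n' l"
    unfolding g' by simp
  also have "tdeg K ?n l + (-2) = (2 * of_int (min_sum K n (Suc j)) + 2 * of_nat (Suc j)) + tdeg K n l"
    unfolding g by simp
  finally show "puiseux_of (fsum K ?a (int l)) = rpow (tdeg K ?n l) * ?P ?n"
    unfolding step' using ih by (simp only: fermionic_eq_def rpow_add mult.assoc)
qed

text \<open>Induction on the sum of \<open>i n_i\<close>, which is the entry \<open>K\<close> of
  \<open>A n\<close>. The largest index \<open>k\<close> of the support is removed by the exchange
  relation if it occurs once, and by the square relation otherwise.\<close>

lemma fermionic_eq:
  assumes "K \<ge> 1" "\<forall>i>K. n i = 0" "min_sum K n K \<le> int K"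
  shows "fermionic_eq K n"
  using assms(2,3)
proof (induction "nat (min_sum K n K)" arbitrary: n rule: less_induct)
  case less
  have IH: "fermionic_eq K n'" if "min_sum K n' K < min_sum K n K" "\<forall>i>K. n' i = 0" for n'
    using that less.prems min_sum_nonneg [of K n' K] by (intro less.hyps) auto
  show ?case
  proof (cases "\<forall>i>0. n i = 0")
    case True
    then show ?thesis using assms(1) by (rule fermionic_eq_base0 [rotated])
  next
    case False
    define k where "k = Max {i. n i \<noteq> 0}"
    have le_K: "i \<le> K" if "n i \<noteq> 0" for i
      using less.prems(1) that by (metis not_le)
    then have "{i. n i \<noteq> 0} \<subseteq> {..K}" by blast
    then have fin: "finite {i. n i \<noteq> 0}"
      by (rule finite_subset) simp
    obtain i where i: "i > 0" "n i \<noteq> 0" using False by blast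
    then have k: "n k \<noteq> 0" "k > 0"
      using Max_in [OF fin] Max_ge [OF fin, of i] unfolding k_def by auto
    have supp: "\<forall>i>k. n i = 0"
      using Max_ge [OF fin] unfolding k_def by (metis mem_Collect_eq not_le)
    have kK: "k \<le> K" using k by (intro le_K)
    obtain j where j: "k = Suc j" using k(2) gr0_implies_Suc by blast
    define n' where "n' = n(k := n k - 1)"
    have n: "n = inc k n'" using k by (auto simp: n'_def inc_def)
    have D: "min_sum K n K = min_sum K n' K + int k"
      using min_sum_inc [OF kK, of n' K] kK unfolding n [symmetric] by simp
    have supp': "\<forall>i>k. n' i = 0" using supp by (simp add: n'_def)
    show ?thesis
    proof (cases "n k = 1")
      case True
      then have supp1: "\<forall>i>j. n' i = 0" using supp by (simp add: n'_def j)
      show ?thesis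
      proof (cases j)
        case 0
        then show ?thesis
          using fermionic_eq_base1 [of K n'] assms(1) supp1 n j by simp
      next
        case (Suc i)
        have "fermionic_eq K (inc (Suc (Suc i)) n')"
        proof (rule fermionic_eq_exchange)
          show "fermionic_eq K (inc (Suc i) n')"
            using kK D min_sum_inc [of "Suc i" K n' K] supp1 by (intro IH) (auto simp: j Suc)
          show "fermionic_eq K (inc i n')"
            using kK D min_sum_inc [of i K n' K] supp1 by (intro IH) (auto simp: j Suc)
        qed (use kK D less.prems supp1 in \<open>auto simp: j Suc\<close>)
        then show ?thesis using n j Suc by simp
      qed
    next
      case False
      define m where "m = n'(k := n' k - 1)"
      have m: "n' = inc k m" using k False by (auto simp: m_def n'_def inc_def fun_eq_iff)
      have D': "min_sum K n' K = min_sum K m K + int k"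
        using min_sum_inc [OF kK, of m K] kK unfolding m [symmetric] by simp
      have suppm: "\<forall>i>Suc j. m i = 0" using supp' by (simp add: m_def j)
      \<comment> \<open>Two copies of \<open>k\<close> force \<open>2 k <= K\<close>, so position
        \<open>k + 1\<close> is still available.\<close>
      have K: "Suc (Suc j) \<le> K"
        using D D' min_sum_nonneg [of K m K] less.prems(2) by (simp add: j)
      have Dj: "min_sum K (inc j m) K = min_sum K m K + int j"
        using min_sum_inc [of j K m K] K by simp
      \<comment> \<open>This vector has the same sum of \<open>i n_i\<close> as \<open>n\<close>, so
        the induction hypothesis does not reach it. The exchange relation over
        \<open>inc j m\<close> reduces it to two vectors with smaller sums.\<close>
      have "fermionic_eq K (inc (Suc (Suc j)) (inc j m))"
      proof (rule fermionic_eq_exchange)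
        show "fermionic_eq K (inc (Suc j) (inc j m))"
          using K D D' Dj min_sum_inc [of "Suc j" K "inc j m" K] suppm by (intro IH) (auto simp: j)
        show "fermionic_eq K (inc j (inc j m))"
          using K D D' Dj min_sum_inc [of j K "inc j m" K] suppm by (intro IH) (auto simp: j)
      qed (use K D D' Dj less.prems suppm in \<open>auto simp: j\<close>)
      moreover have "fermionic_eq K m"
        using K D D' suppm by (intro IH) (auto simp: j)
      ultimately show ?thesis
        using fermionic_eq_square [OF K suppm] n m j by simp
    qed
  qed
qed

end

theorem theorem4p25:
  fixes Q :: "int \<Rightarrow> qtorus"
    and scale :: "laurent \<Rightarrow> 'v::ab_group_add \<Rightarrow> 'v"
    and act :: "'v \<Rightarrow> qtorus \<Rightarrow> 'v"
    and bra :: "nat \<Rightarrow> 'v"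
    and ket :: "nat \<Rightarrow> 'v \<Rightarrow> laurent"
    and n :: "nat \<Rightarrow> nat"
    and k l :: nat
  assumes "quantum_Q_system Q"
    and "cyclic_right_rep scale Q act bra"
    and "dual_basis scale bra ket"
    and "\<forall>i>k. n i = 0"
  shows "puiseux_of (M_stable l n) =
    qpow_rat (- (1/2) * (\<Sum>i=1..k. of_nat (n i))
              - (1/4) * (of_nat l + (\<Sum>i=1..k. \<Sum>j=1..k. of_nat (n i * min i j * n j)))) *
    puiseux_of (ket l (act (bra 0) (prod_list (map (\<lambda>i. Q (int i) ^ n i) [1..<k + 1]))))"
proof -
  interpret Q_rep scale Q act bra ket
    using assms by (intro Q_rep.intro Q_rep_axioms.intro)
  \<comment> \<open>\<open>qword\<close> and \<open>tdeg\<close> start at index \<open>0\<close>,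
    the sums and the product in the claim at \<open>1\<close>; clearing entry \<open>0\<close>
    reconciles them.\<close>
  let ?n = "n(0 := 0)"
  let ?r = "(\<Sum>i=1..k. of_nat (n i)) + (of_nat l + (\<Sum>i=1..k. \<Sum>j=1..k. of_nat (n i * min i j * n j))) / 2 :: rat"
  let ?R = "rpow ?r * puiseux_of (ket l (act (bra 0) (prod_list (map (\<lambda>i. Q (int i) ^ n i) [1..<k + 1]))))"
  define D where "D = (\<Sum>i=1..k. i * n i)"
  have M: "puiseux_of (M_trunc K l n) = ?R" if K: "K \<ge> max 1 (max k D)" for K
  proof -
    have ms: "min_sum K ?n i = (\<Sum>j=1..k. int (min i j) * int (n j))" for i
      unfolding min_sum_def using K assms(4) by (intro sum.mono_neutral_cong_right) auto
    have "min_sum K ?n K = int D"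
      unfolding ms D_def of_nat_sum using K by (intro sum.cong) auto
    then have "fermionic_eq K ?n"
      using K assms(4) by (intro fermionic_eq) auto
    moreover have "min_sum K ?n = min_sum K n"
      by (simp add: fun_eq_iff min_sum_def)
    moreover have "qword K ?n = prod_list (map (\<lambda>i. Q (int i) ^ n i) [1..<k + 1])"
    proof -
      have "qword K ?n = qword k ?n"
        using K assms(4) by (intro qword_stable) auto
      also have "\<dots> = prod_list (map (\<lambda>i. qsol (Suc i) ^ ?n i) [1..<k + 1])"
        unfolding qword_def upt_conv_Cons [OF zero_less_Suc] by (simp del: upt_Suc)
      also have "map (\<lambda>i. qsol (Suc i) ^ ?n i) [1..<k + 1] = map (\<lambda>i. Q (int i) ^ n i) [1..<k + 1]"
        by (intro map_cong) (auto simp: quantum_Q_system_unique [OF assms(1)])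
      finally show ?thesis .
    qed
    moreover have "tdeg K ?n l = ?r"
    proof -
      have "(\<Sum>i\<le>K. ?n i) = (\<Sum>i=1..k. n i)"
        using K assms(4) by (intro sum.mono_neutral_cong_right) (auto simp: not_le)
      moreover have "min_form K ?n = (\<Sum>i=1..k. int (n i) * min_sum K ?n i)"
        unfolding min_form_def using K assms(4) by (intro sum.mono_neutral_cong_right) auto
      then have "min_form K ?n = (\<Sum>i=1..k. \<Sum>j=1..k. int (n i * min i j * n j))"
        unfolding ms by (simp add: sum_distrib_left mult.assoc)
      ultimately show ?thesis
        by (simp add: tdeg_def)
    qed
    ultimately show ?thesis
      using K by (simp add: M_trunc_eq_fsum fermionic_eq_def phi_def)
  qed
  define K0 where "K0 = max 1 (max k D)"
  have M0: "puiseux_of (M_trunc K l n) = ?R" if "K \<ge> K0" for K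
    using that unfolding K0_def by (rule M)
  \<comment> \<open>\<open>?R\<close> does not involve \<open>K\<close>, so stability of the
    truncated sums follows from the identity itself.\<close>
  have "M_trunc K l n = M_trunc K0 l n" if "K \<ge> K0" for K
    by (rule injD [OF inj_puiseux_of]) (simp only: M0 [OF that] M0 [OF order_refl])
  then have ev: "eventually (\<lambda>K. M_trunc K l n = M_trunc K0 l n) sequentially"
    unfolding eventually_sequentially by blast
  have "M_stable l n = M_trunc K0 l n"
    unfolding M_stable_def
  proof (rule the_equality, rule ev)
    fix c assume "eventually (\<lambda>K. M_trunc K l n = c) sequentially"
    with ev have "eventually (\<lambda>K. c = M_trunc K0 l n) sequentially"
      by eventually_elim simp
    then show "c = M_trunc K0 l n" by simp
  qed
  moreover have "qpow_rat (- (1/2) * (\<Sum>i=1..k. of_nat (n i))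
      - (1/4) * (of_nat l + (\<Sum>i=1..k. \<Sum>j=1..k. of_nat (n i * min i j * n j)))) = rpow ?r"
    unfolding qpow_rat_def rpow_def by (intro arg_cong2 [where f = Poly_Mapping.single]) (simp_all add: algebra_simps)
  ultimately show ?thesis
    using M0 [OF order_refl] by (simp only:)
qed

end
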